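(* Let $(M^{2n+s}, \phi, \xi_i, \eta_j, g)$ be an $\eta$-Einstein $\mathcal{S}$-manifold with constants $\alpha,\beta$. Then $M$ is transverse Kähler-Einstein with Einstein constant $\lambda=\alpha+2s$. Conversely, if an $\mathcal{S}$-manifold $(M^{2n+s}, \phi, \xi_i, \eta_j, g)$ is transverse Kähler-Einstein with Einstein constant $\lambda$, then $M$ is $\eta$-Einstein with constants $\alpha, \beta$ given by $\alpha=\lambda-2s$ and $\beta=2n-(\lambda-2s)$.
   Context: A metric $f$-manifold $(M^{2n+s},\phi,\xi_i,\eta_j,g)$ is a smooth connected manifold of dimension $2n+s$ with an endomorphism $\phi$ of $TM$ of constant rank $2n$, global vector fields $\xi_1,\dots,\xi_s$, 1-forms $\eta_1,\dots,\eta_s$ and a Riemannian metric $g$ such that $\mathrm{Ker}(\phi)=\langle\xi_1,\dots,\xi_s\rangle$, $\eta_i(\xi_j)=\delta_{ij}$, $\eta_i\circ\phi=0$, $\phi^2=-\mathrm{Id}+\sum_{i=1}^s\eta_i\otimes\xi_i$, and $g(\phi X,\phi Y)=g(X,Y)-\sum_{i=1}^s\eta_i(X)\eta_i(Y)$. Set $F(X,Y)=g(X,\phi Y)$ and $N^{(1)}=N_\phi+\sum_i d\eta_i\otimes\xi_i$, where $N_\phi(X,Y)=[\phi X,\phi Y]+\phi^2[X,Y]-\phi[X,\phi Y]-\phi[\phi X,Y]$ and $d\eta(X,Y)=X\eta(Y)-Y\eta(X)-\eta([X,Y])$. It is an $\mathcal{S}$-manifold if $s\ge1$, $2F=d\eta_j$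 for all $j$, and $N^{(1)}=0$. Put $\mathcal{D}=\mathrm{Im}(\phi)=\bigcap_i\mathrm{Ker}(\eta_i)$ and $\mathcal{D}^\perp=\mathrm{Ker}(\phi)$, so $TM=\mathcal{D}\oplus\mathcal{D}^\perp$. An $\mathcal{S}$-manifold is $\eta$-Einstein if there are constants $\alpha,\beta$ with $$\mathrm{Ric}^{g}(X, Y)=\alpha\, g(X, Y)+\beta \sum_{i=1}^{s}\eta_{i}(X)\eta_{i}(Y)+(\alpha+\beta)\sum_{1\leq i\neq j\leq s}\eta_{i}(X)\eta_{j}(Y)$$ for all $X,Y\in TM$, where $\mathrm{Ric}^g$ is the Riemannian Ricci tensor. The transverse metric is $\check g=g|_{\mathcal{D}\times\mathcal{D}}$. The transverse Levi-Civita connection $\check\nabla$ on $\mathcal{D}$ is $\check\nabla_XY=(\nabla^g_XY)_{\mathcal{D}}$ for $X,Y\in\mathcal{D}$ and $\check\nabla_XY=[X,Y]_{\mathcal{D}}$ for $X\in\mathcal{D}^\perp,Y\in\mathcal{D}$. Its curvature is $\check R(X,Y)Z=\check\nabla_X\check\nabla_YZ-\check\nabla_Y\check\nabla_XZ-\check\nabla_{[X,Y]}Z$, and the transverse Ricci tensor is $\mathrm{Ric}^{\check g}(X,Y)=\sum_{a=1}^{2n}\check g(\check R(X,e_a)e_a,Y)$ for $X,Y\in\mathcal{D}$, with $\{e_a\}_{a=1}^{2n}$ a $g$-orthonormal basis of $\mathcal{D}$. The $\mathcal{S}$-manifold is transverse Kähler-Einstein with Einstein constant $\lambda$ if $\mathrm{Ric}^{\check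 g}=\lambda\,\check g$ for a real constant $\lambda$. *)

theory Defs
  imports "HOL-Analysis.Analysis" "HOL-Library.Function_Algebras"
begin

section \<open>Smooth manifolds and vector fields\<close>

text \<open>Intended for open \<open>S\<close>; then it is the usual notion of being of class \<open>C\<^sup>k\<close>.\<close>

primrec Ck_on ::
  "nat \<Rightarrow> 'a::real_normed_vector set \<Rightarrow> ('a \<Rightarrow> 'b::real_normed_vector) \<Rightarrow> bool" where
  "Ck_on 0 S f \<longleftrightarrow> continuous_on S f"
| "Ck_on (Suc k) S f \<longleftrightarrow>
     (\<forall>x\<in>S. f differentiable (at x)) \<and>
     (\<forall>v. Ck_on k S (\<lambda>x. frechet_derivative f (at x) v))"

definition smooth_on ::
  "'a::real_normed_vector set \<Rightarrow> ('a \<Rightarrow> 'b::real_normed_vector) \<Rightarrow> bool" where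
  "smooth_on S f \<longleftrightarrow> (\<forall>k. Ck_on k S f)"

text \<open>A chart is a domain together with a coordinate map; only the values of the map on the
  domain matter.\<close>

type_synonym ('m, 'e) chart = "'m set \<times> ('m \<Rightarrow> 'e)"

definition is_chart :: "('m::topological_space, 'e::euclidean_space) chart \<Rightarrow> bool" where
  "is_chart c \<longleftrightarrow> (case c of (U, \<kappa>) \<Rightarrow>
     open U \<and> open (\<kappa> ` U) \<and> (\<exists>\<kappa>'. homeomorphism U (\<kappa> ` U) \<kappa> \<kappa>'))"

definition smoothly_compatible ::
  "('m::topological_space, 'e::euclidean_space) chart \<Rightarrow> ('m, 'e) chart \<Rightarrow> bool" where
  "smoothly_compatible c d \<longleftrightarrow> (case (c, d) of ((U, \<kappa>), (V, \<mu>)) \<Rightarrow>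
     smooth_on (\<kappa> ` (U \<inter> V)) (\<mu> \<circ> inv_into U \<kappa>))"

text \<open>The underlying space is the whole type \<open>'m\<close>; the dimension is \<open>DIM('e)\<close>.\<close>

definition connected_smooth_manifold ::
  "('m::{t2_space, second_countable_topology}, 'e::euclidean_space) chart set \<Rightarrow> bool" where
  "connected_smooth_manifold A \<longleftrightarrow>
     connected (UNIV :: 'm set) \<and>
     (\<forall>c\<in>A. is_chart c) \<and>
     (\<Union>c\<in>A. fst c) = UNIV \<and>
     (\<forall>c\<in>A. \<forall>d\<in>A. smoothly_compatible c d)"

definition smooth_functions ::
  "('m::topological_space, 'e::euclidean_space) chart set \<Rightarrow> ('m \<Rightarrow> real) set" where
  "smooth_functions A = {f. \<forall>(U, \<kappa>)\<in>A. smooth_on (\<kappa> ` U) (f \<circ> inv_into U \<kappa>)}"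

text \<open>
  Vector fields are the derivations of the algebra of smooth functions.  To make a vector
  field determined by its action on smooth functions, it is required to vanish on all other
  functions.  Sums and differences of vector fields are the pointwise ones of
  \<open>HOL-Library.Function_Algebras\<close>.
\<close>

type_synonym 'm vfield = "('m \<Rightarrow> real) \<Rightarrow> ('m \<Rightarrow> real)"

definition vector_fields ::
  "('m::topological_space, 'e::euclidean_space) chart set \<Rightarrow> 'm vfield set" where
  "vector_fields A = {X.
     (\<forall>f\<in>smooth_functions A. X f \<in> smooth_functions A) \<and>
     (\<forall>f\<in>smooth_functions A. \<forall>h\<in>smooth_functions A. X (f + h) = X f + X h) \<and>
     (\<forall>c. \<forall>f\<in>smooth_functions A. X (\<lambda>p. c * f p) = (\<lambda>p. c * X f p)) \<and>
     (\<forall>f\<in>smooth_functions A. \<forall>h\<in>smooth_functions A. X (f * h) = f * X h + h * X f) \<and>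
     (\<forall>f. f \<notin> smooth_functions A \<longrightarrow> X f = 0)}"

definition fscale :: "('m \<Rightarrow> real) \<Rightarrow> 'm vfield \<Rightarrow> 'm vfield" (infixr \<open>\<odot>\<close> 75) where
  "f \<odot> X = (\<lambda>h. f * X h)"

definition lie_bracket :: "'m vfield \<Rightarrow> 'm vfield \<Rightarrow> 'm vfield" where
  "lie_bracket X Y = (\<lambda>f. X (Y f) - Y (X f))"

text \<open>
  The tangent vector of \<open>X\<close> at \<open>p\<close>, as a derivation at \<open>p\<close>.  Since every tangent vector of a
  smooth manifold extends to a global vector field, the tangent space at \<open>p\<close> is the set of the
  \<open>X \<^bold>@ p\<close> with \<open>X \<in> vector_fields A\<close>.
\<close>

type_synonym 'm tvector = "('m \<Rightarrow> real) \<Rightarrow> real"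

definition value_at :: "'m vfield \<Rightarrow> 'm \<Rightarrow> 'm tvector" (infixl \<open>\<^bold>@\<close> 80) where
  "X \<^bold>@ p = (\<lambda>f. X f p)"

definition tscale :: "real \<Rightarrow> 'm tvector \<Rightarrow> 'm tvector" where
  "tscale r v = (\<lambda>f. r * v f)"

abbreviation tspan :: "'m tvector set \<Rightarrow> 'm tvector set" where
  "tspan \<equiv> module.span tscale"

definition has_dimension :: "'m tvector set \<Rightarrow> nat \<Rightarrow> bool" where
  "has_dimension V k \<longleftrightarrow>
     (\<exists>B. finite B \<and> card B = k \<and> \<not> module.dependent tscale B \<and> tspan B = V)"


section \<open>Tensor fields and connections\<close>

text \<open>
  Tensor fields are given by their action on vector fields, as maps linear over the smooth
  functions; their values on arguments that are not vector fields are irrelevant.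
\<close>

definition endomorphism_field ::
  "('m::topological_space, 'e::euclidean_space) chart set \<Rightarrow> ('m vfield \<Rightarrow> 'm vfield) \<Rightarrow> bool"
where
  "endomorphism_field A \<phi> \<longleftrightarrow>
     (\<forall>X\<in>vector_fields A. \<phi> X \<in> vector_fields A) \<and>
     (\<forall>X\<in>vector_fields A. \<forall>Y\<in>vector_fields A. \<phi> (X + Y) = \<phi> X + \<phi> Y) \<and>
     (\<forall>f\<in>smooth_functions A. \<forall>X\<in>vector_fields A. \<phi> (f \<odot> X) = f \<odot> \<phi> X)"

definition one_form ::
  "('m::topological_space, 'e::euclidean_space) chart set \<Rightarrow> ('m vfield \<Rightarrow> ('m \<Rightarrow> real)) \<Rightarrow> bool"
where
  "one_form A \<omega> \<longleftrightarrow>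
     (\<forall>X\<in>vector_fields A. \<omega> X \<in> smooth_functions A) \<and>
     (\<forall>X\<in>vector_fields A. \<forall>Y\<in>vector_fields A. \<omega> (X + Y) = \<omega> X + \<omega> Y) \<and>
     (\<forall>f\<in>smooth_functions A. \<forall>X\<in>vector_fields A. \<omega> (f \<odot> X) = f * \<omega> X)"

definition riemannian_metric ::
  "('m::topological_space, 'e::euclidean_space) chart set \<Rightarrow>
   ('m vfield \<Rightarrow> 'm vfield \<Rightarrow> ('m \<Rightarrow> real)) \<Rightarrow> bool"
where
  "riemannian_metric A g \<longleftrightarrow>
     (\<forall>X\<in>vector_fields A. one_form A (g X)) \<and>
     (\<forall>X\<in>vector_fields A. \<forall>Y\<in>vector_fields A. g X Y = g Y X) \<and>
     (\<forall>X\<in>vector_fields A. \<forall>p. X \<^bold>@ p \<noteq> 0 \<longrightarrow> g X X p > 0)"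

text \<open>The exterior derivative of a 1-form, without a factor \<open>1/2\<close>.\<close>

definition ext_deriv :: "('m vfield \<Rightarrow> ('m \<Rightarrow> real)) \<Rightarrow> 'm vfield \<Rightarrow> 'm vfield \<Rightarrow> ('m \<Rightarrow> real)" where
  "ext_deriv \<omega> X Y = X (\<omega> Y) - Y (\<omega> X) - \<omega> (lie_bracket X Y)"

definition levi_civita_connection ::
  "('m::topological_space, 'e::euclidean_space) chart set \<Rightarrow>
   ('m vfield \<Rightarrow> 'm vfield \<Rightarrow> ('m \<Rightarrow> real)) \<Rightarrow>
   ('m vfield \<Rightarrow> 'm vfield \<Rightarrow> 'm vfield) \<Rightarrow> bool"
where
  "levi_civita_connection A g nab \<longleftrightarrow>
     (\<forall>Y\<in>vector_fields A. endomorphism_field A (\<lambda>X. nab X Y)) \<and>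
     (\<forall>X\<in>vector_fields A. \<forall>Y\<in>vector_fields A. \<forall>Z\<in>vector_fields A.
        nab X (Y + Z) = nab X Y + nab X Z) \<and>
     (\<forall>f\<in>smooth_functions A. \<forall>X\<in>vector_fields A. \<forall>Y\<in>vector_fields A.
        nab X (f \<odot> Y) = X f \<odot> Y + f \<odot> nab X Y) \<and>
     (\<forall>X\<in>vector_fields A. \<forall>Y\<in>vector_fields A. nab X Y - nab Y X = lie_bracket X Y) \<and>
     (\<forall>X\<in>vector_fields A. \<forall>Y\<in>vector_fields A. \<forall>Z\<in>vector_fields A.
        X (g Y Z) = g (nab X Y) Z + g Y (nab X Z))"

definition curvature ::
  "('m vfield \<Rightarrow> 'm vfield \<Rightarrow> 'm vfield) \<Rightarrow>
   'm vfield \<Rightarrow> 'm vfield \<Rightarrow> 'm vfield \<Rightarrow> 'm vfield"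
where
  "curvature nab X Y Z = nab X (nab Y Z) - nab Y (nab X Z) - nab (lie_bracket X Y) Z"

text \<open>
  \<open>\<Gamma>\<close> is the set of sections of a subbundle of rank \<open>k\<close>.  A basis of its fibre at \<open>p\<close> is given
  by sections of the subbundle, whose values at \<open>p\<close> are the basis vectors.
\<close>

definition orthonormal_basis_at ::
  "('m vfield \<Rightarrow> 'm vfield \<Rightarrow> ('m \<Rightarrow> real)) \<Rightarrow> 'm vfield set \<Rightarrow> nat \<Rightarrow> 'm \<Rightarrow>
   (nat \<Rightarrow> 'm vfield) \<Rightarrow> bool"
where
  "orthonormal_basis_at g \<Gamma> k p e \<longleftrightarrow>
     (\<forall>a<k. e a \<in> \<Gamma>) \<and>
     (\<forall>a<k. \<forall>b<k. g (e a) (e b) p = (if a = b then 1 else 0)) \<and>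
     (\<forall>X\<in>\<Gamma>. X \<^bold>@ p \<in> tspan ((\<lambda>a. e a \<^bold>@ p) ` {..<k}))"

text \<open>The Ricci tensor of a connection; the sum does not depend on the basis that is picked nor
  on the sections extending it.\<close>

definition ricci ::
  "('m vfield \<Rightarrow> 'm vfield \<Rightarrow> ('m \<Rightarrow> real)) \<Rightarrow> ('m vfield \<Rightarrow> 'm vfield \<Rightarrow> 'm vfield) \<Rightarrow>
   'm vfield set \<Rightarrow> nat \<Rightarrow> 'm vfield \<Rightarrow> 'm vfield \<Rightarrow> ('m \<Rightarrow> real)"
where
  "ricci g nab \<Gamma> k X Y = (\<lambda>p.
     let e = (SOME e. orthonormal_basis_at g \<Gamma> k p e)
     in \<Sum>a<k. g (curvature nab X (e a) (e a)) Y p)"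


section \<open>Metric f-manifolds and S-manifolds\<close>

text \<open>The indices \<open>1, \<dots>, s\<close> are shifted to \<open>0, \<dots>, s - 1\<close>.\<close>

definition metric_f_manifold ::
  "('m::{t2_space, second_countable_topology}, 'e::euclidean_space) chart set \<Rightarrow> nat \<Rightarrow> nat \<Rightarrow>
   ('m vfield \<Rightarrow> 'm vfield) \<Rightarrow> (nat \<Rightarrow> 'm vfield) \<Rightarrow> (nat \<Rightarrow> 'm vfield \<Rightarrow> ('m \<Rightarrow> real)) \<Rightarrow>
   ('m vfield \<Rightarrow> 'm vfield \<Rightarrow> ('m \<Rightarrow> real)) \<Rightarrow> bool"
where
  "metric_f_manifold A n s \<phi> \<xi> \<eta> g \<longleftrightarrow>
     connected_smooth_manifold A \<and> DIM('e) = 2 * n + s \<and>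
     endomorphism_field A \<phi> \<and>
     (\<forall>i<s. \<xi> i \<in> vector_fields A) \<and>
     (\<forall>i<s. one_form A (\<eta> i)) \<and>
     riemannian_metric A g \<and>
     (\<forall>p. has_dimension ((\<lambda>X. \<phi> X \<^bold>@ p) ` vector_fields A) (2 * n)) \<and>
     (\<forall>p. \<forall>X\<in>vector_fields A.
        \<phi> X \<^bold>@ p = 0 \<longleftrightarrow> X \<^bold>@ p \<in> tspan ((\<lambda>i. \<xi> i \<^bold>@ p) ` {..<s})) \<and>
     (\<forall>i<s. \<forall>j<s. \<eta> i (\<xi> j) = (if i = j then 1 else 0)) \<and>
     (\<forall>i<s. \<forall>X\<in>vector_fields A. \<eta> i (\<phi> X) = 0) \<and>
     (\<forall>X\<in>vector_fields A. \<phi> (\<phi> X) = - X + (\<Sum>i<s. \<eta> i X \<odot> \<xi> i)) \<and>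
     (\<forall>X\<in>vector_fields A. \<forall>Y\<in>vector_fields A.
        g (\<phi> X) (\<phi> Y) = g X Y - (\<Sum>i<s. \<eta> i X * \<eta> i Y))"

definition fundamental_form ::
  "('m vfield \<Rightarrow> 'm vfield) \<Rightarrow> ('m vfield \<Rightarrow> 'm vfield \<Rightarrow> ('m \<Rightarrow> real)) \<Rightarrow>
   'm vfield \<Rightarrow> 'm vfield \<Rightarrow> ('m \<Rightarrow> real)"
where
  "fundamental_form \<phi> g X Y = g X (\<phi> Y)"

definition nijenhuis ::
  "('m vfield \<Rightarrow> 'm vfield) \<Rightarrow> 'm vfield \<Rightarrow> 'm vfield \<Rightarrow> 'm vfield"
where
  "nijenhuis \<phi> X Y =
     lie_bracket (\<phi> X) (\<phi> Y) + \<phi> (\<phi> (lie_bracket X Y))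
       - \<phi> (lie_bracket X (\<phi> Y)) - \<phi> (lie_bracket (\<phi> X) Y)"

definition normality_tensor ::
  "nat \<Rightarrow> ('m vfield \<Rightarrow> 'm vfield) \<Rightarrow> (nat \<Rightarrow> 'm vfield) \<Rightarrow>
   (nat \<Rightarrow> 'm vfield \<Rightarrow> ('m \<Rightarrow> real)) \<Rightarrow> 'm vfield \<Rightarrow> 'm vfield \<Rightarrow> 'm vfield"
where
  "normality_tensor s \<phi> \<xi> \<eta> X Y =
     nijenhuis \<phi> X Y + (\<Sum>i<s. ext_deriv (\<eta> i) X Y \<odot> \<xi> i)"

definition S_manifold ::
  "('m::{t2_space, second_countable_topology}, 'e::euclidean_space) chart set \<Rightarrow> nat \<Rightarrow> nat \<Rightarrow>
   ('m vfield \<Rightarrow> 'm vfield) \<Rightarrow> (nat \<Rightarrow> 'm vfield) \<Rightarrow> (nat \<Rightarrow> 'm vfield \<Rightarrow> ('m \<Rightarrow> real)) \<Rightarrow>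
   ('m vfield \<Rightarrow> 'm vfield \<Rightarrow> ('m \<Rightarrow> real)) \<Rightarrow> bool"
where
  "S_manifold A n s \<phi> \<xi> \<eta> g \<longleftrightarrow>
     metric_f_manifold A n s \<phi> \<xi> \<eta> g \<and> s \<ge> 1 \<and>
     (\<forall>j<s. \<forall>X\<in>vector_fields A. \<forall>Y\<in>vector_fields A.
        (\<lambda>p. 2 * fundamental_form \<phi> g X Y p) = ext_deriv (\<eta> j) X Y) \<and>
     (\<forall>X\<in>vector_fields A. \<forall>Y\<in>vector_fields A. normality_tensor s \<phi> \<xi> \<eta> X Y = 0)"

text \<open>
  In \<open>eta_Einstein\<close> and \<open>transverse_Kaehler_Einstein\<close>, \<open>nab\<close> is meant to be the Levi-Civita
  connection of \<open>g\<close>, which on vector fields is uniquely determined by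
  \<open>levi_civita_connection A g nab\<close>.
\<close>

definition eta_Einstein ::
  "('m::topological_space, 'e::euclidean_space) chart set \<Rightarrow> nat \<Rightarrow> nat \<Rightarrow>
   (nat \<Rightarrow> 'm vfield \<Rightarrow> ('m \<Rightarrow> real)) \<Rightarrow> ('m vfield \<Rightarrow> 'm vfield \<Rightarrow> ('m \<Rightarrow> real)) \<Rightarrow>
   ('m vfield \<Rightarrow> 'm vfield \<Rightarrow> 'm vfield) \<Rightarrow> real \<Rightarrow> real \<Rightarrow> bool"
where
  "eta_Einstein A n s \<eta> g nab \<alpha> \<beta> \<longleftrightarrow>
     (\<forall>X\<in>vector_fields A. \<forall>Y\<in>vector_fields A. \<forall>p.
        ricci g nab (vector_fields A) (2 * n + s) X Y p =
          \<alpha> * g X Y p + \<beta> * (\<Sum>i<s. \<eta> i X p * \<eta> i Y p)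
            + (\<alpha> + \<beta>) * (\<Sum>i<s. \<Sum>j\<in>{..<s} - {i}. \<eta> i X p * \<eta> j Y p))"

definition sections_D ::
  "('m::topological_space, 'e::euclidean_space) chart set \<Rightarrow> nat \<Rightarrow>
   (nat \<Rightarrow> 'm vfield \<Rightarrow> ('m \<Rightarrow> real)) \<Rightarrow> 'm vfield set"
where
  "sections_D A s \<eta> = {X\<in>vector_fields A. \<forall>i<s. \<eta> i X = 0}"

text \<open>The projections to the two summands of \<open>TM = \<D> \<oplus> \<D>\<^sup>\<bottom>\<close>.\<close>

definition D_perp_part ::
  "nat \<Rightarrow> (nat \<Rightarrow> 'm vfield) \<Rightarrow> (nat \<Rightarrow> 'm vfield \<Rightarrow> ('m \<Rightarrow> real)) \<Rightarrow> 'm vfield \<Rightarrow> 'm vfield"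
where
  "D_perp_part s \<xi> \<eta> X = (\<Sum>i<s. \<eta> i X \<odot> \<xi> i)"

definition D_part ::
  "nat \<Rightarrow> (nat \<Rightarrow> 'm vfield) \<Rightarrow> (nat \<Rightarrow> 'm vfield \<Rightarrow> ('m \<Rightarrow> real)) \<Rightarrow> 'm vfield \<Rightarrow> 'm vfield"
where
  "D_part s \<xi> \<eta> X = X - D_perp_part s \<xi> \<eta> X"

text \<open>A general direction \<open>X\<close> is split into its components in \<open>\<D>\<close> and \<open>\<D>\<^sup>\<bottom>\<close>, on which the
  transverse connection is \<open>(nab X Y)\<^sub>\<D>\<close> and \<open>[X, Y]\<^sub>\<D>\<close> respectively.\<close>

definition transverse_connection ::
  "nat \<Rightarrow> (nat \<Rightarrow> 'm vfield) \<Rightarrow> (nat \<Rightarrow> 'm vfield \<Rightarrow> ('m \<Rightarrow> real)) \<Rightarrow>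
   ('m vfield \<Rightarrow> 'm vfield \<Rightarrow> 'm vfield) \<Rightarrow> 'm vfield \<Rightarrow> 'm vfield \<Rightarrow> 'm vfield"
where
  "transverse_connection s \<xi> \<eta> nab X Y =
     D_part s \<xi> \<eta> (nab (D_part s \<xi> \<eta> X) Y) + D_part s \<xi> \<eta> (lie_bracket (D_perp_part s \<xi> \<eta> X) Y)"

definition transverse_Kaehler_Einstein ::
  "('m::topological_space, 'e::euclidean_space) chart set \<Rightarrow> nat \<Rightarrow> nat \<Rightarrow>
   (nat \<Rightarrow> 'm vfield) \<Rightarrow> (nat \<Rightarrow> 'm vfield \<Rightarrow> ('m \<Rightarrow> real)) \<Rightarrow>
   ('m vfield \<Rightarrow> 'm vfield \<Rightarrow> ('m \<Rightarrow> real)) \<Rightarrow> ('m vfield \<Rightarrow> 'm vfield \<Rightarrow> 'm vfield) \<Rightarrow>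
   real \<Rightarrow> bool"
where
  "transverse_Kaehler_Einstein A n s \<xi> \<eta> g nab c \<longleftrightarrow>
     (\<forall>X\<in>sections_D A s \<eta>. \<forall>Y\<in>sections_D A s \<eta>. \<forall>p.
        ricci g (transverse_connection s \<xi> \<eta> nab) (sections_D A s \<eta>) (2 * n) X Y p =
          c * g X Y p)"

end

theory Submission
  imports Defs
begin

text \<open>
  A vector field that vanishes at \<open>p\<close> is a combination of vector fields with coefficients vanishing at
  \<open>p\<close>, so every \<open>C\<^sup>\<infinity>\<close>-linear expression is pointwise, and the Ricci tensor of \<open>g\<close> may be
  computed in an orthonormal basis of \<open>\<D>\<close> completed by \<open>\<xi>\<^sub>1, \<dots>, \<xi>\<^sub>s\<close>.

  The \<open>\<xi>\<^sub>i\<close> are Killing with \<open>\<nabla>\<^sub>X \<xi>\<^sub>i = -\<phi>X\<close>, whence the transverse connection is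
  \<open>\<nabla>\<^sub>X Y + (\<Sum>i. \<eta>\<^sub>i(X)) \<phi>Y + g(\<phi>Y, X) (\<Sum>i. \<xi>\<^sub>i)\<close> and its curvature satisfies
  \<open>g(R\<^sup>T(X, e) e, Y) = g(R(X, e) e, Y) + 3s g(\<phi>e, X) g(\<phi>e, Y)\<close> on \<open>\<D>\<close>.  Together with
  \<open>R(X, \<xi>\<^sub>i) \<xi>\<^sub>j = -\<phi>\<^sup>2 X\<close> the trace gives \<open>Ric\<^sup>T = Ric + 2s g\<close> on \<open>\<D>\<close>.  Finally
  \<open>R(X, Y) \<xi>\<^sub>i = (\<nabla>\<^sub>Y \<phi>) X - (\<nabla>\<^sub>X \<phi>) Y\<close>, where \<open>\<nabla>\<phi>\<close> vanishes on \<open>\<D>\<close> because the transverse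
  structure is Kaehler, so always \<open>Ric(\<D>, \<xi>\<^sub>i) = 0\<close> and \<open>Ric(\<xi>\<^sub>i, \<xi>\<^sub>j) = 2n\<close>.
\<close>

section \<open>Calculus of smooth functions on open sets\<close>

text \<open>Vector fields are derivations of the algebra of global smooth functions, so it is not
  built in that an expression linear over this algebra sees only values at a point. The Ricci
  tensors force a proof of this, since \<open>ricci\<close> sums over an arbitrarily chosen basis
  whose members are orthonormal only at \<open>p\<close>; Hadamard's lemma and bump functions serve
  this one purpose. The transverse Ricci tensor keeps the basis of D chosen for it, and the Ricci
  tensor of g is moved to the completion of that same basis, so that the two are compared summand by
  summand. The shape of the coefficients comes from all \<eta>_i having the same differential 2F.
  Vertical parts of derivatives of horizontal fields therefore point along the sum of the \<xi>_i,
  which puts the factor s on every correction, and Ric(\<xi>_i, \<xi>_j) has the same value for i =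
  j and for distinct i, j, which is why \<alpha> + \<beta> stands before the mixed terms.\<close>

lemma frechet_derivative_cong_open:
  assumes "open S" "x \<in> S" "\<And>y. y \<in> S \<Longrightarrow> f y = h y"
  shows "f differentiable (at x) \<longleftrightarrow> h differentiable (at x)"
    and "f differentiable (at x) \<Longrightarrow> frechet_derivative f (at x) = frechet_derivative h (at x)"
proof -
  have "(f has_derivative D) (at x) \<longleftrightarrow> (h has_derivative D) (at x)" for D
    using assms has_derivative_transform_within_open[of _ D x UNIV S] by (metis)
  then show "f differentiable (at x) \<longleftrightarrow> h differentiable (at x)"
    by (simp add: differentiable_def)
  show "f differentiable (at x) \<Longrightarrow> frechet_derivative f (at x) = frechet_derivative h (at x)"
    using assms frechet_derivative_transform_within_open by blast
qed

lemma Ck_on_cong: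
  assumes "open S" "\<And>x. x \<in> S \<Longrightarrow> f x = h x"
  shows "Ck_on k S f \<longleftrightarrow> Ck_on k S h"
  using assms
proof (induction k arbitrary: f h)
  case 0
  then show ?case by (auto intro: continuous_on_eq)
next
  case (Suc k)
  have d: "f differentiable (at x) \<longleftrightarrow> h differentiable (at x)"
    if "x \<in> S" for x
    using frechet_derivative_cong_open[OF Suc.prems(1) that] Suc.prems(2) by blast
  have "Ck_on k S (\<lambda>x. frechet_derivative f (at x) v) \<longleftrightarrow> Ck_on k S (\<lambda>x. frechet_derivative h (at x) v)"
    if "\<forall>x\<in>S. f differentiable (at x)" for v
  proof (intro Suc.IH Suc.prems(1))
    fix x assume "x \<in> S"
    with frechet_derivative_cong_open(2)[OF Suc.prems(1) this Suc.prems(2)] that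
    show "frechet_derivative f (at x) v = frechet_derivative h (at x) v" by simp
  qed
  with d show ?case by auto
qed

lemma Ck_on_subset: "Ck_on k S f \<Longrightarrow> T \<subseteq> S \<Longrightarrow> Ck_on k T f"
  by (induction k arbitrary: f) (auto intro: continuous_on_subset)

lemma Ck_on_continuous: "Ck_on k S f \<Longrightarrow> continuous_on S f"
proof (cases k)
  case (Suc j)
  assume "Ck_on k S f"
  with Suc have "continuous (at x) f" if "x \<in> S" for x
    using that by (auto intro: differentiable_imp_continuous_within)
  then show ?thesis by (rule continuous_at_imp_continuous_on[rule_format])
qed simp

lemma Ck_on_SucD: "Ck_on (Suc k) S f \<Longrightarrow> Ck_on k S f"
proof (induction k arbitrary: f)
  case 0
  then show ?case using Ck_on_continuous[of "Suc 0"] by simp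
qed auto

text \<open>\<open>Ck_on\<close> takes derivatives at single points of the whole space, so the
  gluing happens only in the continuity of the base case.\<close>

lemma Ck_on_Un:
  assumes "open S" "open T" "Ck_on k S f" "Ck_on k T f"
  shows "Ck_on k (S \<union> T) f"
  using assms(3,4)
proof (induction k arbitrary: f)
  case 0
  with assms show ?case by (auto intro: continuous_on_open_Un)
qed auto

text \<open>Lets the derivative be given by any formula \<open>D\<close>; by uniqueness it agrees
  with \<open>frechet_derivative\<close> on the open set \<open>S\<close>.\<close>

lemma Ck_on_SucI:
  assumes "open S" "\<And>x. x \<in> S \<Longrightarrow> (f has_derivative D x) (at x)"
    "\<And>v. Ck_on k S (\<lambda>x. D x v)"
  shows "Ck_on (Suc k) S f"
proof -
  have "frechet_derivative f (at x) = D x" if "x \<in> S" for x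
    using assms(2)[OF that] frechet_derivative_at by metis
  then have "Ck_on k S (\<lambda>x. frechet_derivative f (at x) v) \<longleftrightarrow> Ck_on k S (\<lambda>x. D x v)" for v
    by (intro Ck_on_cong assms(1)) simp
  then show ?thesis
    using assms by (auto simp: differentiable_def)
qed

lemma Ck_on_SucD2:
  assumes "Ck_on (Suc k) S f"
  shows "x \<in> S \<Longrightarrow> (f has_derivative frechet_derivative f (at x)) (at x)"
    and "Ck_on k S (\<lambda>x. frechet_derivative f (at x) v)"
  using assms frechet_derivative_works by auto

lemma Ck_on_const: "Ck_on k S (\<lambda>x. c)"
  by (induction k arbitrary: c) auto

lemma Ck_on_add:
  assumes "open S" "Ck_on k S f" "Ck_on k S h"
  shows "Ck_on k S (\<lambda>x. f x + h x)"
  using assms(2,3)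
proof (induction k arbitrary: f h)
  case (Suc k)
  show ?case
    by (rule Ck_on_SucI[OF \<open>open S\<close> has_derivative_add[OF Ck_on_SucD2(1)[OF Suc.prems(1)]
          Ck_on_SucD2(1)[OF Suc.prems(2)]]])
      (use Ck_on_SucD2(2)[OF Suc.prems(1)] Ck_on_SucD2(2)[OF Suc.prems(2)] Suc.IH in auto)
qed (auto intro: continuous_intros)

lemma Ck_on_sum:
  assumes "open S" "\<And>i. i \<in> I \<Longrightarrow> Ck_on k S (f i)"
  shows "Ck_on k S (\<lambda>x. \<Sum>i\<in>I. f i x)"
proof (cases "finite I")
  case True
  then show ?thesis using assms(2)
    by (induction) (auto intro: Ck_on_add[OF assms(1)] Ck_on_const)
qed (simp add: Ck_on_const)

lemma Ck_on_mult:
  fixes f h :: "'a::real_normed_vector \<Rightarrow> real"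
  assumes "open S" "Ck_on k S f" "Ck_on k S h"
  shows "Ck_on k S (\<lambda>x. f x * h x)"
  using assms(2,3)
proof (induction k arbitrary: f h)
  case (Suc k)
  show ?case
    by (rule Ck_on_SucI[OF \<open>open S\<close> has_derivative_mult[OF Ck_on_SucD2(1)[OF Suc.prems(1)]
          Ck_on_SucD2(1)[OF Suc.prems(2)]]])
      (use Ck_on_SucD2(2)[OF Suc.prems(1)] Ck_on_SucD2(2)[OF Suc.prems(2)] Suc.IH
          Ck_on_SucD[OF Suc.prems(1)] Ck_on_SucD[OF Suc.prems(2)] in
        \<open>auto intro!: Ck_on_add[OF \<open>open S\<close>]\<close>)
qed (auto intro: continuous_intros)

lemma Ck_on_bounded_linear:
  assumes "open S" "bounded_linear L"
  shows "Ck_on k S L"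
proof (cases k)
  case 0
  with assms show ?thesis by (auto intro: linear_continuous_on)
next
  case (Suc k)
  have "Ck_on (Suc k) S L"
    by (rule Ck_on_SucI[OF assms(1) bounded_linear_imp_has_derivative[OF assms(2)]])
      (rule Ck_on_const)
  with Suc show ?thesis by simp
qed

lemma Ck_on_inner:
  fixes f :: "'a::real_normed_vector \<Rightarrow> 'b::real_inner"
  assumes "open S" "Ck_on k S f"
  shows "Ck_on k S (\<lambda>x. f x \<bullet> b)"
  using assms(2)
proof (induction k arbitrary: f)
  case (Suc k)
  show ?case
    by (rule Ck_on_SucI[OF \<open>open S\<close> has_derivative_inner_left[OF Ck_on_SucD2(1)[OF Suc.prems]]])
      (use Ck_on_SucD2(2)[OF Suc.prems] Suc.IH in auto)
qed (auto intro: continuous_intros)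

lemma linear_eq_sum_Basis:
  fixes F :: "'a::euclidean_space \<Rightarrow> real"
  assumes "linear F"
  shows "F w = (\<Sum>b\<in>Basis. (w \<bullet> b) * F b)"
proof -
  have "F w = F (\<Sum>b\<in>Basis. (w \<bullet> b) *\<^sub>R b)" by (simp add: euclidean_representation)
  also have "\<dots> = (\<Sum>b\<in>Basis. (w \<bullet> b) * F b)"
    by (simp only: linear_sum[OF assms] linear_scale[OF assms] real_scaleR_def)
  finally show ?thesis .
qed

lemma Ck_on_compose:
  fixes f :: "'b::euclidean_space \<Rightarrow> real" and h :: "'a::real_normed_vector \<Rightarrow> 'b"
  assumes "open S" "open T" "h ` S \<subseteq> T" "Ck_on k T f" "Ck_on k S h"
  shows "Ck_on k S (\<lambda>x. f (h x))"
  using assms(4,5)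
proof (induction k arbitrary: f)
  case 0
  with assms show ?case by (auto intro: continuous_on_compose2)
next
  case (Suc k)
  let ?D = "\<lambda>x. frechet_derivative h (at x)" and ?F = "\<lambda>y. frechet_derivative f (at y)"
  \<comment> \<open>In the chain rule both the base point and the direction of \<open>?F\<close>
    vary with \<open>x\<close>. Expanding the direction in \<open>Basis\<close> leaves products of
    functions with fixed directions, which the induction hypothesis covers.\<close>
  have der: "((\<lambda>x. f (h x)) has_derivative (\<lambda>v. \<Sum>b\<in>Basis. (?D x v \<bullet> b) * ?F (h x) b)) (at x)"
    if x: "x \<in> S" for x
  proof -
    have f: "(f has_derivative ?F (h x)) (at (h x))"
      using Ck_on_SucD2(1)[OF Suc.prems(1)] x assms(3) by blast
    have "((\<lambda>x. f (h x)) has_derivative (\<lambda>v. ?F (h x) (?D x v))) (at x)"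
      using diff_chain_at[OF Ck_on_SucD2(1)[OF Suc.prems(2) x] f] by (simp add: o_def)
    then show ?thesis
      by (rule has_derivative_eq_rhs)
        (rule ext, rule linear_eq_sum_Basis[OF has_derivative_linear[OF f]])
  qed
  show ?case
    by (rule Ck_on_SucI[OF \<open>open S\<close> der])
      (use Suc.prems Ck_on_SucD[OF Suc.prems(2)] in
        \<open>auto intro!: Ck_on_sum Ck_on_mult Ck_on_inner Suc.IH assms(1) simp del: Ck_on.simps(1)\<close>)
qed

section \<open>Flat functions and bump functions\<close>

lemma poly_mult_exp_neg_tendsto_0:
  "((\<lambda>x::real. poly P x * exp (- x)) \<longlongrightarrow> 0) at_top"
proof -
  have "((\<lambda>x::real. \<Sum>i\<le>degree P. coeff P i * (x ^ i / exp x)) \<longlongrightarrow> (\<Sum>i\<le>degree P. coeff P i * 0)) at_top"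
    by (intro tendsto_intros tendsto_power_div_exp_0)
  then show ?thesis
    by (simp add: poly_altdef sum_distrib_right exp_minus divide_inverse mult.assoc)
qed

text \<open>The polynomial factor makes the family closed under differentiation;
  \<open>flat 1\<close> is the classical flat function.\<close>

definition flat :: "real poly \<Rightarrow> real \<Rightarrow> real" where
  "flat P t = (if t > 0 then poly P (1 / t) * exp (- (1 / t)) else 0)"

lemma flat_tendsto_0: "(flat P \<longlongrightarrow> 0) (at 0)"
proof -
  have "((\<lambda>t. poly P (1 / t) * exp (- (1 / t))) \<longlongrightarrow> 0) (at_right (0::real))"
    by (rule filterlim_compose[OF poly_mult_exp_neg_tendsto_0])
      (simp add: filterlim_inverse_at_top_right divide_inverse)
  then have "(flat P \<longlongrightarrow> 0) (at_right 0)"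
    by (rule tendsto_cong[THEN iffD1, rotated])
      (auto simp: flat_def eventually_at intro!: exI[of _ 1])
  moreover have "(flat P \<longlongrightarrow> 0) (at_left 0)"
    by (rule tendsto_eventually) (auto simp: flat_def eventually_at intro!: exI[of _ 1])
  ultimately show ?thesis by (simp add: filterlim_split_at)
qed

text \<open>With u = 1/t, d/dt is -u^2 d/du, which turns P(u) exp(-u) into u^2 (P - P')(u) exp(-u).
  At 0 the difference quotient of \<open>flat P\<close> is itself a member of the family, so it
  tends to 0.\<close>

lemma flat_has_derivative:
  "(flat P has_field_derivative flat ([:0, 0, 1:] * (P - pderiv P)) t) (at t)"
proof -
  consider "t > 0" | "t < 0" | "t = 0" by linarith
  then show ?thesis
  proof cases
    case 1
    have *: "((\<lambda>t. poly P (1 / t) * exp (- (1 / t))) has_field_derivative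
      flat ([:0, 0, 1:] * (P - pderiv P)) t) (at t)"
      using 1
      by (auto intro!: derivative_eq_intros poly_DERIV[THEN DERIV_chain2]
          simp: flat_def field_simps power2_eq_square)
    show ?thesis
      by (rule has_field_derivative_transform_within_open[OF *, of "{0<..}"])
        (use 1 in \<open>auto simp: flat_def\<close>)
  next
    case 2
    show ?thesis
      by (rule has_field_derivative_transform_within_open[of "\<lambda>_. 0" _ _ "{..<0}"])
        (use 2 in \<open>auto simp: flat_def\<close>)
  next
    case 3
    have "flat P h / h = flat ([:0, 1:] * P) h" for h
      by (auto simp: flat_def)
    then show ?thesis
      using flat_tendsto_0[of "[:0, 1:] * P"] 3 by (simp add: DERIV_def flat_def[of _ 0])
  qed
qed

lemma Ck_on_flat: "Ck_on k UNIV (flat P)"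
proof (induction k arbitrary: P)
  case 0
  then show ?case
    using flat_has_derivative DERIV_isCont continuous_at_imp_continuous_on by (metis Ck_on.simps(1))
next
  case (Suc k)
  show ?case
    by (rule Ck_on_SucI[OF _ flat_has_derivative[unfolded has_field_derivative_def]])
      (auto intro!: Ck_on_mult Suc.IH Ck_on_const)
qed

lemma bump_exists:
  fixes a :: "'a::euclidean_space"
  assumes "r > 0"
  obtains \<rho> :: "'a \<Rightarrow> real" where "smooth_on UNIV \<rho>" "\<rho> a = 1" "\<And>x. x \<notin> cball a r \<Longrightarrow> \<rho> x = 0"
proof -
  \<comment> \<open>This is r^2 minus the squared distance from \<open>a\<close>, written as a
    polynomial in the coordinates so that the closure rules of \<open>Ck_on\<close> apply.\<close>
  define q where "q x = r\<^sup>2 + (\<Sum>b\<in>Basis. (- 1) * ((x \<bullet> b + - (a \<bullet> b)) * (x \<bullet> b + - (a \<bullet> b))))" for x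
  have q: "q x = r\<^sup>2 - (dist a x)\<^sup>2" for x
    unfolding q_def dist_norm norm_minus_commute[of a] power2_norm_eq_inner
      euclidean_inner[of "x - a" "x - a"]
    by (simp add: sum_negf inner_diff_left)
  have sq: "Ck_on k UNIV q" for k
    unfolding q_def
    by (intro Ck_on_add Ck_on_sum Ck_on_mult Ck_on_const open_UNIV Ck_on_bounded_linear
        bounded_linear_inner_left)
  show thesis
  proof
    have "Ck_on k UNIV (\<lambda>x. flat 1 (q x))" for k
      by (rule Ck_on_compose[OF open_UNIV open_UNIV _ Ck_on_flat sq]) simp
    then show "smooth_on UNIV (\<lambda>x. inverse (flat 1 (r\<^sup>2)) * flat 1 (q x))"
      unfolding smooth_on_def
      by (intro allI Ck_on_mult[OF open_UNIV Ck_on_const])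
    show "inverse (flat 1 (r\<^sup>2)) * flat 1 (q a) = 1"
      using assms by (simp add: q flat_def)
    show "inverse (flat 1 (r\<^sup>2)) * flat 1 (q x) = 0" if "x \<notin> cball a r" for x
    proof -
      have "q x < 0" using that assms by (simp add: q power_strict_mono)
      then show ?thesis by (simp add: flat_def)
    qed
  qed
qed

section \<open>Differentiation under the integral and Hadamard's lemma\<close>

lemma convex_segment_mem:
  fixes q y :: "'a::real_vector"
  assumes "convex S" "q \<in> S" "y \<in> S" "t \<in> {0..1}"
  shows "q + t *\<^sub>R (y - q) \<in> S"
proof -
  have "(1 - t) *\<^sub>R q + t *\<^sub>R y \<in> S"
    using assms by (intro convexD) auto
  then show ?thesis by (simp add: algebra_simps)
qed

text \<open>Each differentiation in \<open>x\<close> brings out a factor \<open>t\<close>. The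
  weight \<open>w\<close> absorbs it, so the derivative is an integral of the same form and
  smoothness follows by induction.\<close>

lemma parametric_integral_has_derivative:
  fixes G :: "'a::euclidean_space \<Rightarrow> real"
  assumes S: "open S" "convex S" "q \<in> S" and G: "Ck_on (Suc k) S G"
    and w: "continuous_on {0..1} w" and x: "x \<in> S"
  shows "((\<lambda>x. integral {0..1} (\<lambda>t. w t * G (q + t *\<^sub>R (x - q)))) has_derivative
    (\<lambda>v. integral {0..1} (\<lambda>t. (w t * t) * frechet_derivative G (at (q + t *\<^sub>R (x - q))) v))) (at x)"
proof -
  let ?F = "\<lambda>y. frechet_derivative G (at y)"
  \<comment> \<open>\<open>leibniz_rule\<close> asks for a derivative that is continuous as a map
    into bounded linear operators; in finite dimension this is checked for one direction at a
    time.\<close>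
  define B where "B y = Blinfun (?F y)" for y
  have bl: "bounded_linear (?F y)" if "y \<in> S" for y
    using Ck_on_SucD2(1)[OF G that] has_derivative_bounded_linear by blast
  have B: "blinfun_apply (B y) = ?F y" if "y \<in> S" for y
    using bl[OF that] by (simp add: B_def bounded_linear_Blinfun_apply)
  have seg: "q + t *\<^sub>R (y - q) \<in> S" if "y \<in> S" "t \<in> {0..1}" for y t
    using convex_segment_mem S that by blast
  have contF: "continuous_on S (\<lambda>y. ?F y v)" for v
    using Ck_on_SucD2(2)[OF G] Ck_on_continuous by blast
  have contB: "continuous_on S B"
    by (intro continuous_on_blinfun_componentwise, rule continuous_on_eq[OF contF]) (simp add: B)
  have contw: "continuous_on (S \<times> {0..1}) (\<lambda>z. w (snd z))"
    by (rule continuous_on_compose2[OF w]) (auto intro: continuous_intros)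
  have segc: "continuous_on (S \<times> {0..1}) (\<lambda>z::'a\<times>real. q + snd z *\<^sub>R (fst z - q))"
    by (intro continuous_intros)
  have "((\<lambda>x. integral (cbox 0 1) (\<lambda>t. w t * G (q + t *\<^sub>R (x - q)))) has_derivative
    integral (cbox 0 1) (\<lambda>t. (w t * t) *\<^sub>R B (q + t *\<^sub>R (x - q)))) (at x within S)"
  proof (rule leibniz_rule)
    fix y t assume y: "y \<in> S" and t: "t \<in> cbox 0 (1::real)"
    then have yt: "q + t *\<^sub>R (y - q) \<in> S" using seg by auto
    have "((\<lambda>x. q + t *\<^sub>R (x - q)) has_derivative (\<lambda>v. t *\<^sub>R v)) (at y within S)"
      by (auto intro!: derivative_eq_intros)
    from has_derivative_compose[OF this Ck_on_SucD2(1)[OF G yt]]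
    have "((\<lambda>x. w t * G (q + t *\<^sub>R (x - q))) has_derivative (\<lambda>v. w t * ?F (q + t *\<^sub>R (y - q)) (t *\<^sub>R v))) (at y within S)"
      by (intro has_derivative_mult_right)
    then show "((\<lambda>x. w t * G (q + t *\<^sub>R (x - q))) has_derivative
      blinfun_apply ((w t * t) *\<^sub>R B (q + t *\<^sub>R (y - q)))) (at y within S)"
      by (rule has_derivative_eq_rhs)
        (use yt bl[OF yt] in \<open>auto simp: B blinfun.scaleR_left linear_scale bounded_linear.linear\<close>)
  next
    fix y assume y: "y \<in> S"
    have "continuous_on {0..1} (\<lambda>t. w t * G (q + t *\<^sub>R (y - q)))"
      by (intro continuous_intros w continuous_on_compose2[OF Ck_on_continuous[OF G]])
        (use seg y in auto)
    then show "(\<lambda>t. w t * G (q + t *\<^sub>R (y - q))) integrable_on cbox 0 1"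
      by (simp add: integrable_continuous_real)
  next
    have "continuous_on (S \<times> {0..1}) (\<lambda>z. (w (snd z) * snd z) *\<^sub>R B (q + snd z *\<^sub>R (fst z - q)))"
      by (intro continuous_intros contw continuous_on_compose2[OF contB segc])
        (use seg in auto)
    then show "continuous_on (S \<times> cbox 0 1) (\<lambda>(x, t). (w t * t) *\<^sub>R B (q + t *\<^sub>R (x - q)))"
      by (simp add: split_beta)
  qed (use S x in auto)
  moreover have "blinfun_apply (integral (cbox 0 1) (\<lambda>t. (w t * t) *\<^sub>R B (q + t *\<^sub>R (x - q)))) v =
    integral {0..1} (\<lambda>t. (w t * t) * ?F (q + t *\<^sub>R (x - q)) v)" for v
  proof -
    have "continuous_on {0..1} (\<lambda>t. (w t * t) *\<^sub>R B (q + t *\<^sub>R (x - q)))"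
      by (intro continuous_intros w continuous_on_compose2[OF contB]) (use seg x in auto)
    then have "(\<lambda>t. (w t * t) *\<^sub>R B (q + t *\<^sub>R (x - q))) integrable_on cbox 0 1"
      by (simp add: integrable_continuous_real)
    from integral_linear[OF this blinfun.bounded_linear_left[of v]]
    have "blinfun_apply (integral (cbox 0 1) (\<lambda>t. (w t * t) *\<^sub>R B (q + t *\<^sub>R (x - q)))) v =
      integral {0..1} (\<lambda>t. blinfun_apply ((w t * t) *\<^sub>R B (q + t *\<^sub>R (x - q))) v)"
      by (simp add: o_def)
    also have "\<dots> = integral {0..1} (\<lambda>t. (w t * t) * ?F (q + t *\<^sub>R (x - q)) v)"
      by (intro integral_cong) (simp add: blinfun.scaleR_left B seg x)
    finally show ?thesis .
  qed
  then have "blinfun_apply (integral (cbox 0 1) (\<lambda>t. (w t * t) *\<^sub>R B (q + t *\<^sub>R (x - q)))) =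
    (\<lambda>v. integral {0..1} (\<lambda>t. (w t * t) * ?F (q + t *\<^sub>R (x - q)) v))" by blast
  ultimately show ?thesis
    using at_within_open[OF x S(1)] by simp
qed

lemma Ck_on_parametric_integral:
  fixes G :: "'a::euclidean_space \<Rightarrow> real"
  assumes S: "open S" "convex S" "q \<in> S" and G: "Ck_on k S G" and w: "continuous_on {0..1} w"
  shows "Ck_on k S (\<lambda>x. integral {0..1} (\<lambda>t. w t * G (q + t *\<^sub>R (x - q))))"
  using G w
proof (induction k arbitrary: G w)
  case 0
  have "q + t *\<^sub>R (y - q) \<in> S" if "y \<in> S" "t \<in> {0..1}" for y t
    using convex_segment_mem S that by blast
  then have "continuous_on (S \<times> {0..1}) (\<lambda>z. w (snd z) * G (q + snd z *\<^sub>R (fst z - q)))"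
    by (intro continuous_intros continuous_on_compose2[OF 0(2)]
        continuous_on_compose2[OF 0(1)[simplified]]) auto
  then have "continuous_on S (\<lambda>x. integral (cbox 0 1) (\<lambda>t. w t * G (q + t *\<^sub>R (x - q))))"
    by (intro integral_continuous_on_param) (simp add: split_beta)
  then show ?case by simp
next
  case (Suc k)
  show ?case
    by (rule Ck_on_SucI[OF S(1) parametric_integral_has_derivative[OF S Suc.prems]])
      (auto intro!: Suc.IH Ck_on_SucD2(2)[OF Suc.prems(1)] continuous_intros Suc.prems(2))
qed

text \<open>Integrate the derivative of \<open>f\<close> along the segment from \<open>q\<close> to
  \<open>x\<close> and expand \<open>x - q\<close> in \<open>Basis\<close>; \<open>h b\<close> is
  the mean of the partial derivative in direction \<open>b\<close>.\<close>

lemma Hadamard: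
  fixes f :: "'a::euclidean_space \<Rightarrow> real"
  assumes S: "open S" "convex S" "q \<in> S" and f: "smooth_on S f"
  obtains h where "\<And>b. smooth_on S (h b)" "\<And>b. h b q = frechet_derivative f (at q) b"
    "\<And>x. x \<in> S \<Longrightarrow> f x = f q + (\<Sum>b\<in>Basis. ((x - q) \<bullet> b) * h b x)"
proof
  \<comment> \<open>The factor 1 is the weight \<open>w\<close> of
    \<open>Ck_on_parametric_integral\<close>.\<close>
  let ?h = "\<lambda>b x. integral {0..1} (\<lambda>t. 1 * frechet_derivative f (at (q + t *\<^sub>R (x - q))) b)"
  have sf: "Ck_on k S (\<lambda>x. frechet_derivative f (at x) b)" for k b
    using f Ck_on_SucD2(2) unfolding smooth_on_def by blast
  show "smooth_on S (?h b)" for b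
    unfolding smooth_on_def
    by (intro allI Ck_on_parametric_integral[OF S sf]) auto
  show "?h b q = frechet_derivative f (at q) b" for b
    by simp
  fix x assume x: "x \<in> S"
  have seg: "q + t *\<^sub>R (x - q) \<in> S" if "t \<in> {0..1}" for t
    using convex_segment_mem S x that by blast
  have der: "(f has_derivative frechet_derivative f (at y)) (at y)" if "y \<in> S" for y
    using f that Ck_on_SucD2(1) unfolding smooth_on_def by blast
  have "((\<lambda>t. f (q + t *\<^sub>R (x - q))) has_vector_derivative
      frechet_derivative f (at (q + t *\<^sub>R (x - q))) (x - q)) (at t within {0..1})" if t: "t \<in> {0..1}" for t
  proof -
    have "((\<lambda>t. q + t *\<^sub>R (x - q)) has_derivative (\<lambda>v. v *\<^sub>R (x - q))) (at t within {0..1})"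
      by (auto intro!: derivative_eq_intros)
    from has_derivative_compose[OF this der[OF seg[OF t]]]
    show ?thesis
      unfolding has_vector_derivative_def
      by (rule has_derivative_eq_rhs)
        (use has_derivative_linear[OF der[OF seg[OF t]]] in \<open>auto simp: linear_scale\<close>)
  qed
  then have int: "((\<lambda>t. frechet_derivative f (at (q + t *\<^sub>R (x - q))) (x - q)) has_integral
      (f (q + 1 *\<^sub>R (x - q)) - f (q + 0 *\<^sub>R (x - q)))) {0..1}"
    by (intro fundamental_theorem_of_calculus) auto
  have integrable: "(\<lambda>t. frechet_derivative f (at (q + t *\<^sub>R (x - q))) b) integrable_on {0..1}" for b
    by (intro integrable_continuous_real continuous_on_compose2[OF Ck_on_continuous[OF sf]]
        continuous_intros) (use seg in auto)
  have "f x - f q = integral {0..1} (\<lambda>t. frechet_derivative f (at (q + t *\<^sub>R (x - q))) (x - q))"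
    using int by (simp add: integral_unique)
  also have "\<dots> = integral {0..1} (\<lambda>t. \<Sum>b\<in>Basis. ((x - q) \<bullet> b) * frechet_derivative f (at (q + t *\<^sub>R (x - q))) b)"
    by (intro integral_cong)
      (rule linear_eq_sum_Basis[OF has_derivative_linear[OF der[OF seg]]])
  also have "\<dots> = (\<Sum>b\<in>Basis. ((x - q) \<bullet> b) * ?h b x)"
    by (subst integral_sum) (auto intro!: integrable_on_mult_right integrable)
  finally show "f x = f q + (\<Sum>b\<in>Basis. ((x - q) \<bullet> b) * ?h b x)" by simp
qed

text \<open>The open sets \<open>B\<close> and \<open>- K\<close> cover the space, and the extension
  vanishes on the second.\<close>

lemma Ck_on_extend_zero:
  assumes "open B" "compact K" "K \<subseteq> B" "Ck_on k B u" "\<And>x. x \<in> B - K \<Longrightarrow> u x = 0"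
  shows "Ck_on k UNIV (\<lambda>x. if x \<in> B then u x else 0)"
proof -
  let ?v = "\<lambda>x. if x \<in> B then u x else 0"
  have "Ck_on k B ?v"
    using Ck_on_cong[OF assms(1), of u ?v k] assms(4) by simp
  moreover have "Ck_on k (- K) ?v"
  proof (subst Ck_on_cong[of "- K" _ "\<lambda>_. 0"])
    show "open (- K)" using assms(2) compact_imp_closed by auto
    show "?v x = 0" if "x \<in> - K" for x using that assms(5) by simp
  qed (rule Ck_on_const)
  ultimately have "Ck_on k (B \<union> - K) ?v"
    using assms compact_imp_closed by (intro Ck_on_Un) auto
  moreover have "B \<union> - K = UNIV" using assms by auto
  ultimately show ?thesis by simp
qed

section \<open>Smooth functions and vector fields\<close>

lemma sum_fun_apply: "sum f I x = (\<Sum>i\<in>I. f i x)"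
  by (induction I rule: infinite_finite_induct) auto

locale smooth_manifold =
  fixes A :: "('m::{t2_space, second_countable_topology}, 'e::euclidean_space) chart set"
  assumes manifold: "connected_smooth_manifold A"
begin

abbreviation "C \<equiv> smooth_functions A"
abbreviation "VF \<equiv> vector_fields A"

lemma chartD:
  assumes "(U, \<kappa>) \<in> A"
  shows "open U" "open (\<kappa> ` U)" "inj_on \<kappa> U" "continuous_on (\<kappa> ` U) (inv_into U \<kappa>)"
proof -
  have "is_chart (U, \<kappa>)" using manifold assms by (auto simp: connected_smooth_manifold_def)
  then obtain \<kappa>' where o: "open U" "open (\<kappa> ` U)" and h: "homeomorphism U (\<kappa> ` U) \<kappa> \<kappa>'"
    by (auto simp: is_chart_def)
  show "open U" "open (\<kappa> ` U)" by (fact o)+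
  show inj: "inj_on \<kappa> U"
    using h by (metis homeomorphism_apply1 inj_onI)
  have "inv_into U \<kappa> y = \<kappa>' y" if "y \<in> \<kappa> ` U" for y
    using h inj that by (auto simp: homeomorphism_apply1)
  then show "continuous_on (\<kappa> ` U) (inv_into U \<kappa>)"
    using h by (metis continuous_on_cong homeomorphism_cont2)
qed

lemma open_chart_image:
  assumes "(U, \<kappa>) \<in> A" "W \<subseteq> U" "open W"
  shows "open (\<kappa> ` W)"
proof -
  have "\<kappa> ` W = \<kappa> ` U \<inter> inv_into U \<kappa> -` W"
    using assms(2) chartD(3)[OF assms(1)] by (auto simp: subset_iff)
  then show ?thesis
    using continuous_open_preimage[OF chartD(4,2)[OF assms(1)] assms(3)] by simp
qed

lemma smooth_functionsD:
  assumes "f \<in> C" "(U, \<kappa>) \<in> A"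
  shows "smooth_on (\<kappa> ` U) (\<lambda>x. f (inv_into U \<kappa> x))"
  using assms by (auto simp: smooth_functions_def o_def)

lemma smooth_functionsI:
  assumes "\<And>U \<kappa> k. (U, \<kappa>) \<in> A \<Longrightarrow> Ck_on k (\<kappa> ` U) (\<lambda>x. f (inv_into U \<kappa> x))"
  shows "f \<in> C"
  using assms by (auto simp: smooth_functions_def smooth_on_def o_def)

lemma const_smooth [simp]: "(\<lambda>p. c) \<in> C"
  by (rule smooth_functionsI) (rule Ck_on_const)

lemma one_smooth [simp]: "1 \<in> C" and zero_smooth [simp]: "0 \<in> C"
  by (simp_all add: one_fun_def zero_fun_def)

lemma plus_smooth [simp]: "f \<in> C \<Longrightarrow> h \<in> C \<Longrightarrow> f + h \<in> C"
  by (rule smooth_functionsI)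
    (auto intro!: Ck_on_add chartD dest!: smooth_functionsD simp: smooth_on_def)

lemma times_smooth [simp]: "f \<in> C \<Longrightarrow> h \<in> C \<Longrightarrow> f * h \<in> C"
  by (rule smooth_functionsI)
    (auto intro!: Ck_on_mult chartD dest!: smooth_functionsD simp: smooth_on_def)

lemma scale_smooth [simp]: "f \<in> C \<Longrightarrow> (\<lambda>p. c * f p) \<in> C"
  using times_smooth[OF const_smooth[of c]] by (simp add: times_fun_def)

lemma uminus_smooth [simp]: "f \<in> C \<Longrightarrow> - f \<in> C"
  using scale_smooth[of f "- 1"] by (simp add: fun_Compl_def)

lemma minus_smooth [simp]: "f \<in> C \<Longrightarrow> h \<in> C \<Longrightarrow> f - h \<in> C"
  using plus_smooth[of f "- h"] by simp

lemma sum_smooth [simp]: "(\<And>i. i \<in> I \<Longrightarrow> f i \<in> C) \<Longrightarrow> sum f I \<in> C"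
  by (induction I rule: infinite_finite_induct) auto

text \<open>In another chart the function is \<open>u\<close> after the transition map on the
  overlap, and zero off the preimage of \<open>K\<close>. This preimage is compact, hence closed
  because the manifold is Hausdorff, so both pieces are open.\<close>

lemma chart_extension_smooth:
  assumes c: "(U, \<kappa>) \<in> A" and u: "smooth_on UNIV u"
    and K: "compact K" "K \<subseteq> \<kappa> ` U" "\<And>x. x \<notin> K \<Longrightarrow> u x = 0"
  shows "(\<lambda>m. if m \<in> U then u (\<kappa> m) else 0) \<in> C"
proof (rule smooth_functionsI)
  fix V \<mu> k assume d: "(V, \<mu>) \<in> A"
  let ?u = "\<lambda>m. if m \<in> U then u (\<kappa> m) else 0" and ?\<mu>' = "inv_into V \<mu>"
  define K' where "K' = inv_into U \<kappa> ` K"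
  have "compact K'"
    unfolding K'_def using K continuous_on_subset[OF chartD(4)[OF c]] compact_continuous_image by blast
  then have clK: "closed K'" by (rule compact_imp_closed)
  have K'U: "K' \<subseteq> U" using K(2) by (auto simp: K'_def inv_into_into)
  have o1: "open (\<mu> ` (V \<inter> U))" and o2: "open (\<mu> ` (V - K'))"
    using chartD(1)[OF c] chartD(1)[OF d] clK by (auto intro!: open_chart_image[OF d] open_Int open_Diff)
  have "smoothly_compatible (V, \<mu>) (U, \<kappa>)"
    using manifold c d by (auto simp: connected_smooth_manifold_def)
  then have "Ck_on k (\<mu> ` (V \<inter> U)) (\<kappa> \<circ> ?\<mu>')"
    by (simp add: smoothly_compatible_def smooth_on_def)
  then have "Ck_on k (\<mu> ` (V \<inter> U)) (\<lambda>x. u ((\<kappa> \<circ> ?\<mu>') x))"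
    by (rule Ck_on_compose[OF o1 open_UNIV subset_UNIV u[unfolded smooth_on_def, rule_format]])
  then have "Ck_on k (\<mu> ` (V \<inter> U)) (\<lambda>x. ?u (?\<mu>' x))"
    using chartD(3)[OF d] by (subst Ck_on_cong[OF o1, of _ "\<lambda>x. u ((\<kappa> \<circ> ?\<mu>') x)"]) auto
  moreover have "?u m = 0" if "m \<in> V - K'" for m
  proof (cases "m \<in> U")
    case True
    then have "\<kappa> m \<notin> K"
      using that chartD(3)[OF c] by (force simp: K'_def)
    with K(3) show ?thesis by simp
  qed simp
  then have "Ck_on k (\<mu> ` (V - K')) (\<lambda>x. ?u (?\<mu>' x))"
    using chartD(3)[OF d] by (subst Ck_on_cong[OF o2, of _ "\<lambda>x. 0"]) (force simp: Ck_on_const)+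
  ultimately have "Ck_on k (\<mu> ` (V \<inter> U) \<union> \<mu> ` (V - K')) (\<lambda>x. ?u (?\<mu>' x))"
    by (intro Ck_on_Un o1 o2)
  moreover have "\<mu> ` (V \<inter> U) \<union> \<mu> ` (V - K') = \<mu> ` V" using K'U by blast
  ultimately show "Ck_on k (\<mu> ` V) (\<lambda>x. ?u (?\<mu>' x))" by simp
qed

section \<open>The module of vector fields\<close>

lemma vf_smooth [simp]: "X \<in> VF \<Longrightarrow> f \<in> C \<Longrightarrow> X f \<in> C"
  and vf_plus: "X \<in> VF \<Longrightarrow> f \<in> C \<Longrightarrow> h \<in> C \<Longrightarrow> X (f + h) = X f + X h"
  and vf_scale: "X \<in> VF \<Longrightarrow> f \<in> C \<Longrightarrow> X (\<lambda>p. c * f p) = (\<lambda>p. c * X f p)"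
  and vf_times: "X \<in> VF \<Longrightarrow> f \<in> C \<Longrightarrow> h \<in> C \<Longrightarrow> X (f * h) = f * X h + h * X f"
  and vf_not_smooth: "X \<in> VF \<Longrightarrow> f \<notin> C \<Longrightarrow> X f = 0"
  by (auto simp: vector_fields_def)

lemma vf_const [simp]: "X \<in> VF \<Longrightarrow> X (\<lambda>p. c) = 0"
proof -
  assume X: "X \<in> VF"
  have "X 1 = X 1 + X 1" using vf_times[OF X, of 1 1] by simp
  then have "X 1 = 0" by simp
  then show ?thesis using vf_scale[OF X, of 1 c] by (simp add: zero_fun_def)
qed

lemma vf_zero [simp]: "X \<in> VF \<Longrightarrow> X 0 = 0" and vf_one [simp]: "X \<in> VF \<Longrightarrow> X 1 = 0"
  unfolding zero_fun_def one_fun_def by (simp_all add: zero_fun_def)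

lemma vf_uminus: "X \<in> VF \<Longrightarrow> f \<in> C \<Longrightarrow> X (- f) = - X f"
  using vf_scale[of X f "- 1"] by (simp add: fun_Compl_def[of f] fun_Compl_def[of "X f"])

lemma vf_minus: "X \<in> VF \<Longrightarrow> f \<in> C \<Longrightarrow> h \<in> C \<Longrightarrow> X (f - h) = X f - X h"
  using vf_plus[of X f "- h"] vf_uminus[of X h] by simp

lemma vf_sum: "X \<in> VF \<Longrightarrow> (\<And>i. i \<in> I \<Longrightarrow> f i \<in> C) \<Longrightarrow> X (sum f I) = (\<Sum>i\<in>I. X (f i))"
  by (induction I rule: infinite_finite_induct) (auto simp: vf_plus)

lemma vfI:
  assumes "\<And>f. f \<in> C \<Longrightarrow> X f \<in> C"
    "\<And>f h. f \<in> C \<Longrightarrow> h \<in> C \<Longrightarrow> X (f + h) = X f + X h"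
    "\<And>f c. f \<in> C \<Longrightarrow> X (\<lambda>p. c * f p) = (\<lambda>p. c * X f p)"
    "\<And>f h. f \<in> C \<Longrightarrow> h \<in> C \<Longrightarrow> X (f * h) = f * X h + h * X f"
    "\<And>f. f \<notin> C \<Longrightarrow> X f = 0"
  shows "X \<in> VF"
  unfolding vector_fields_def mem_Collect_eq using assms by (intro conjI ballI allI impI)

lemma zero_vf [simp]: "0 \<in> VF"
  by (rule vfI) (auto simp: fun_eq_iff)

lemma plus_vf [simp]: "X \<in> VF \<Longrightarrow> Y \<in> VF \<Longrightarrow> X + Y \<in> VF"
  by (rule vfI) (auto simp: fun_eq_iff vf_plus vf_scale vf_times vf_not_smooth algebra_simps)

lemma fscale_vf [simp]: "f \<in> C \<Longrightarrow> X \<in> VF \<Longrightarrow> f \<odot> X \<in> VF"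
  by (rule vfI) (auto simp: fscale_def fun_eq_iff vf_plus vf_scale vf_times vf_not_smooth algebra_simps)

lemma uminus_vf [simp]: "X \<in> VF \<Longrightarrow> - X \<in> VF"
  by (rule vfI) (auto simp: fun_eq_iff vf_plus vf_scale vf_times vf_not_smooth algebra_simps)

lemma minus_vf [simp]: "X \<in> VF \<Longrightarrow> Y \<in> VF \<Longrightarrow> X - Y \<in> VF"
  using plus_vf[of X "- Y"] by simp

lemma sum_vf [simp]: "(\<And>i. i \<in> I \<Longrightarrow> X i \<in> VF) \<Longrightarrow> sum X I \<in> VF"
  by (induction I rule: infinite_finite_induct) auto

lemma lie_bracket_vf [simp]: "X \<in> VF \<Longrightarrow> Y \<in> VF \<Longrightarrow> lie_bracket X Y \<in> VF"
proof (rule vfI)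
  assume X: "X \<in> VF" and Y: "Y \<in> VF"
  fix f h c assume f: "f \<in> C"
  show "lie_bracket X Y (\<lambda>p. c * f p) = (\<lambda>p. c * lie_bracket X Y f p)"
    using X Y f by (simp add: lie_bracket_def vf_scale) (simp add: fun_eq_iff algebra_simps)
  assume h: "h \<in> C"
  show "lie_bracket X Y (f + h) = lie_bracket X Y f + lie_bracket X Y h"
    "lie_bracket X Y (f * h) = f * lie_bracket X Y h + h * lie_bracket X Y f"
    unfolding lie_bracket_def
    by (simp_all only: vf_plus[OF X] vf_plus[OF Y] vf_times[OF X] vf_times[OF Y]
        vf_smooth[OF X] vf_smooth[OF Y] times_smooth f h)
      (simp_all add: algebra_simps)
qed (simp_all add: lie_bracket_def vf_not_smooth)

text \<open>Hadamard's lemma at a point \<open>q\<close> of the chart, multiplied by \<open>\<rho>\<^sup>2\<close> so that all functions are global: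
  \<open>\<rho>\<^sup>2 (f - f(q)) = (\<Sum>b. (\<rho> x\<^sub>b - q\<^sub>b \<rho>) (\<rho> h\<^sub>b))\<close>.  Applying the derivation \<open>X\<close> and evaluating at \<open>q\<close> gives
  \<open>\<rho>\<^sup>3 X = (\<Sum>b. (\<rho> X(y\<^sub>b) - y\<^sub>b X(\<rho>)) E\<^sub>b)\<close> with \<open>y\<^sub>b = \<rho> x\<^sub>b\<close> and \<open>E\<^sub>b = \<rho> \<partial>\<^sub>b\<close>.\<close>

lemma cutoff_frame:
  obtains \<rho> E where "\<rho> \<in> C" "\<rho> p = 1" "\<And>b. E b \<in> VF"
    "\<And>X. X \<in> VF \<Longrightarrow> \<exists>c. (\<forall>b. c b \<in> C) \<and> (X \<^bold>@ p = 0 \<longrightarrow> (\<forall>b. c b p = 0)) \<and>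
        (\<rho> * \<rho> * \<rho>) \<odot> X = (\<Sum>b\<in>Basis. c b \<odot> E (b :: 'e))"
proof -
  have "p \<in> (\<Union>c\<in>A. fst c)" using manifold by (simp add: connected_smooth_manifold_def)
  then obtain U \<kappa> where c: "(U, \<kappa>) \<in> A" and p: "p \<in> U" by auto
  then obtain e where e: "e > 0" "ball (\<kappa> p) e \<subseteq> \<kappa> ` U"
    using chartD(2)[OF c] by (metis image_eqI openE)
  define B where "B = ball (\<kappa> p) e"
  define K where "K = cball (\<kappa> p) (e / 2)"
  have B: "open B" "convex B" "\<kappa> p \<in> B" "B \<subseteq> \<kappa> ` U"
    using e by (auto simp: B_def)
  have K: "compact K" "K \<subseteq> B" using e by (auto simp: K_def B_def)
  obtain \<sigma> :: "'e \<Rightarrow> real" where \<sigma>: "smooth_on UNIV \<sigma>" "\<sigma> (\<kappa> p) = 1" "\<And>x. x \<notin> K \<Longrightarrow> \<sigma> x = 0"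
    by (rule bump_exists[OF half_gt_zero[OF e(1)], of "\<kappa> p", folded K_def]) (rule that)
  \<comment> \<open>Turns functions on the coordinate ball into global ones: \<open>\<rho>\<close>,
    \<open>y b\<close>, \<open>E b f\<close> and the Hadamard factors are all of the form
    \<open>L u\<close>.\<close>
  define L where "L u m = (if m \<in> U \<and> \<kappa> m \<in> B then \<sigma> (\<kappa> m) * u (\<kappa> m) else 0)" for u m
  have L: "L u \<in> C" if u: "smooth_on B u" for u
  proof -
    have "Ck_on k B (\<lambda>x. \<sigma> x * u x)" for k
      using u \<sigma>(1) Ck_on_subset[of k UNIV \<sigma> B] by (intro Ck_on_mult B) (auto simp: smooth_on_def)
    then have "smooth_on UNIV (\<lambda>x. if x \<in> B then \<sigma> x * u x else 0)"
      unfolding smooth_on_def by (auto intro!: Ck_on_extend_zero[OF B(1) K] simp: \<sigma>(3))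
    then have "(\<lambda>m. if m \<in> U then (if \<kappa> m \<in> B then \<sigma> (\<kappa> m) * u (\<kappa> m) else 0) else 0) \<in> C"
      by (rule chart_extension_smooth[OF c _ K(1)]) (use K(2) B(4) \<sigma>(3) in auto)
    moreover have "L u = (\<lambda>m. if m \<in> U then (if \<kappa> m \<in> B then \<sigma> (\<kappa> m) * u (\<kappa> m) else 0) else 0)"
      by (auto simp: L_def fun_eq_iff)
    ultimately show ?thesis by simp
  qed
  let ?t = "\<lambda>f x. f (inv_into U \<kappa> x)"
  have sm: "Ck_on k B (?t f)" if "f \<in> C" for f k
    using smooth_functionsD[OF that c] Ck_on_subset[OF _ B(4)] by (auto simp: smooth_on_def)
  define E where "E b f = (if f \<in> C then L (\<lambda>x. frechet_derivative (?t f) (at x) b) else 0)" for b f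
  have der: "(?t f has_derivative frechet_derivative (?t f) (at x)) (at x)" if "f \<in> C" "x \<in> B" for f x
    using Ck_on_SucD2(1)[OF sm[OF that(1), of "Suc 0"] that(2)] .
  have inv: "inv_into U \<kappa> (\<kappa> m) = m" if "m \<in> U" for m
    using chartD(3)[OF c] that by simp
  have EVF: "E b \<in> VF" for b
  proof (rule vfI)
    show "E b f \<in> C" if "f \<in> C" for f
      using that Ck_on_SucD2(2)[OF sm[OF that]] by (auto simp: E_def smooth_on_def intro!: L)
    show "E b (f + h) = E b f + E b h" if "f \<in> C" "h \<in> C" for f h
    proof -
      have "frechet_derivative (?t (f + h)) (at x) b =
        frechet_derivative (?t f) (at x) b + frechet_derivative (?t h) (at x) b" if "x \<in> B" for x
        using fun_cong[OF frechet_derivative_at[OF has_derivative_add[OF der[OF \<open>f \<in> C\<close> that] der[OF \<open>h \<in> C\<close> that]]], of b] by simp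
      then show ?thesis using that by (auto simp: E_def L_def fun_eq_iff algebra_simps)
    qed
    show "E b (\<lambda>p. r * f p) = (\<lambda>p. r * E b f p)" if "f \<in> C" for f r
    proof -
      have "frechet_derivative (?t (\<lambda>p. r * f p)) (at x) b =
        r * frechet_derivative (?t f) (at x) b" if "x \<in> B" for x
        using fun_cong[OF frechet_derivative_at[OF has_derivative_mult_right[OF der[OF \<open>f \<in> C\<close> that]]], of r b] by simp
      then show ?thesis using that by (auto simp: E_def L_def fun_eq_iff)
    qed
    show "E b (f * h) = f * E b h + h * E b f" if "f \<in> C" "h \<in> C" for f h
    proof -
      have "frechet_derivative (?t (f * h)) (at x) b =
        ?t f x * frechet_derivative (?t h) (at x) b + frechet_derivative (?t f) (at x) b * ?t h x" if "x \<in> B" for x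
        using fun_cong[OF frechet_derivative_at[OF has_derivative_mult[OF der[OF \<open>f \<in> C\<close> that] der[OF \<open>h \<in> C\<close> that]]], of b] by simp
      then show ?thesis using that by (auto simp: E_def L_def fun_eq_iff inv algebra_simps)
    qed
    show "E b f = 0" if "f \<notin> C" for f using that by (simp add: E_def)
  qed
  define \<rho> where "\<rho> = L (\<lambda>x. 1)"
  define y where "y b = L (\<lambda>x. x \<bullet> b)" for b :: 'e
  have \<rho>: "\<rho> \<in> C" unfolding \<rho>_def by (rule L) (simp add: smooth_on_def Ck_on_const)
  have y: "y b \<in> C" for b
    unfolding y_def by (rule L) (auto simp: smooth_on_def intro!: Ck_on_bounded_linear B bounded_linear_inner_left)
  show thesis
  proof
    show "\<rho> p = 1" using p B \<sigma>(2) by (simp add: \<rho>_def L_def)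
    fix X assume X: "X \<in> VF"
    define d where "d b = \<rho> * X (y b) - y b * X \<rho>" for b
    \<comment> \<open>Hadamard's lemma is used at every point \<open>m\<close> of the chart ball,
      not only at \<open>p\<close>, because the identity of vector fields has to hold
      globally.\<close>
    have pt: "\<rho> m * \<rho> m * \<rho> m * X f m = (\<Sum>b\<in>Basis. d b m * E b f m)" if f: "f \<in> C" for f m
    proof (cases "m \<in> U \<and> \<kappa> m \<in> B")
      case False
      then have "\<rho> m = 0" "E b f m = 0" for b by (auto simp: \<rho>_def E_def L_def)
      then show ?thesis by simp
    next
      case True
      let ?q = "\<kappa> m"
      have smB: "smooth_on B (?t f)" using sm[OF f] by (simp add: smooth_on_def)
      obtain h where h: "\<And>b. smooth_on B (h b)" "\<And>b. h b ?q = frechet_derivative (?t f) (at ?q) b"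
        "\<And>x. x \<in> B \<Longrightarrow> ?t f x = ?t f ?q + (\<Sum>b\<in>Basis. ((x - ?q) \<bullet> b) * h b x)"
        using Hadamard[OF B(1,2) _ smB, of ?q] True by blast
      define z where "z b = y b - (\<lambda>_. ?q \<bullet> b) * \<rho>" for b
      have z: "z b \<in> C" for b using y \<rho> by (simp add: z_def)
      have eq: "(\<rho> * \<rho>) * (f - (\<lambda>_. f m)) = (\<Sum>b\<in>Basis. z b * L (h b))"
      proof
        fix m'
        show "((\<rho> * \<rho>) * (f - (\<lambda>_. f m))) m' = (\<Sum>b\<in>Basis. z b * L (h b)) m'"
        proof (cases "m' \<in> U \<and> \<kappa> m' \<in> B")
          case False
          then have "L v m' = 0" for v by (auto simp: L_def)
          then show ?thesis by (simp add: sum_fun_apply \<rho>_def)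
        next
          case m': True
          then have "f m' - f m = (\<Sum>b\<in>Basis. ((\<kappa> m' - ?q) \<bullet> b) * h b (\<kappa> m'))"
            using h(3)[of "\<kappa> m'"] inv True by simp
          with m' show ?thesis
            by (simp add: sum_fun_apply \<rho>_def L_def z_def y_def sum_distrib_left inner_diff_left algebra_simps)
        qed
      qed
      \<comment> \<open>As \<open>z b\<close> vanishes at \<open>m\<close>, the product rule applied
        to \<open>eq\<close> keeps only the derivative of \<open>z b\<close> there.\<close>
      have zm: "z b m = 0" "X (z b) m = X (y b) m - (?q \<bullet> b) * X \<rho> m" "L (h b) m = E b f m" for b
        using True f y \<rho> X h(2)
        by (simp_all add: z_def y_def \<rho>_def L_def E_def) (simp add: z_def vf_minus vf_times)
      have "\<rho> m * \<rho> m * X f m = X ((\<rho> * \<rho>) * (f - (\<lambda>_. f m))) m"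
        using X f \<rho> by (simp add: vf_times vf_minus)
      also have "\<dots> = (\<Sum>b\<in>Basis. (X (y b) m - (?q \<bullet> b) * X \<rho> m) * E b f m)"
        using X z L[OF h(1)] by (simp add: eq vf_sum vf_times sum_fun_apply zm mult.commute)
      \<comment> \<open>The third factor \<open>\<rho>\<close> removes the base point from the
        coefficients: at \<open>m\<close> it turns the constant \<open>?q \<bullet> b\<close> into
        \<open>y b\<close>, a global smooth function.\<close>
      finally have "\<rho> m * (\<rho> m * \<rho> m * X f m) = (\<Sum>b\<in>Basis. \<rho> m * ((X (y b) m - (?q \<bullet> b) * X \<rho> m) * E b f m))"
        by (simp add: sum_distrib_left)
      moreover have "\<rho> m * ((X (y b) m - (?q \<bullet> b) * X \<rho> m) * E b f m) = d b m * E b f m" for b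
        using True by (simp add: d_def y_def \<rho>_def L_def algebra_simps)
      ultimately show ?thesis by (simp add: mult.assoc)
    qed
    have "((\<rho> * \<rho> * \<rho>) \<odot> X) f m = (\<Sum>b\<in>Basis. d b \<odot> E b) f m" for f m
    proof (cases "f \<in> C")
      case True
      then show ?thesis by (simp add: fscale_def sum_fun_apply pt)
    next
      case False
      then show ?thesis by (simp add: fscale_def sum_fun_apply vf_not_smooth[OF X] vf_not_smooth[OF EVF])
    qed
    then have "(\<rho> * \<rho> * \<rho>) \<odot> X = (\<Sum>b\<in>Basis. d b \<odot> E b)" by blast
    moreover have "\<forall>b. d b \<in> C" using X \<rho> y by (simp add: d_def)
    moreover have "X \<^bold>@ p = 0 \<longrightarrow> (\<forall>b. d b p = 0)"
      by (auto simp: d_def value_at_def fun_eq_iff)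
    ultimately show "\<exists>c. (\<forall>b. c b \<in> C) \<and> (X \<^bold>@ p = 0 \<longrightarrow> (\<forall>b. c b p = 0)) \<and>
        (\<rho> * \<rho> * \<rho>) \<odot> X = (\<Sum>b\<in>Basis. c b \<odot> E b)" by blast
  qed (fact \<rho> EVF)+
qed

section \<open>Maps that depend only on the value at a point\<close>

definition tensorial_at :: "'m \<Rightarrow> ('m vfield \<Rightarrow> real) \<Rightarrow> bool" where
  "tensorial_at p L \<longleftrightarrow> (\<forall>X\<in>VF. \<forall>Y\<in>VF. L (X + Y) = L X + L Y) \<and>
     (\<forall>f\<in>C. \<forall>X\<in>VF. L (f \<odot> X) = f p * L X)"

lemma tensorial_atI:
  assumes "\<And>X Y. X \<in> VF \<Longrightarrow> Y \<in> VF \<Longrightarrow> L (X + Y) = L X + L Y"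
    "\<And>f X. f \<in> C \<Longrightarrow> X \<in> VF \<Longrightarrow> L (f \<odot> X) = f p * L X"
  shows "tensorial_at p L"
  using assms by (auto simp: tensorial_at_def)

lemma tensorial_at_fscale: "tensorial_at p L \<Longrightarrow> f \<in> C \<Longrightarrow> X \<in> VF \<Longrightarrow> L (f \<odot> X) = f p * L X"
  and tensorial_at_plus: "tensorial_at p L \<Longrightarrow> X \<in> VF \<Longrightarrow> Y \<in> VF \<Longrightarrow> L (X + Y) = L X + L Y"
  by (auto simp: tensorial_at_def)

lemma tensorial_at_zero: "tensorial_at p L \<Longrightarrow> L 0 = 0"
  using tensorial_at_plus[of p L 0 0] by simp

lemma tensorial_at_sum:
  assumes "tensorial_at p L" "\<And>i. i \<in> I \<Longrightarrow> f i \<in> C" "\<And>i. i \<in> I \<Longrightarrow> X i \<in> VF"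
  shows "L (\<Sum>i\<in>I. f i \<odot> X i) = (\<Sum>i\<in>I. f i p * L (X i))"
  using assms(2,3)
  by (induction I rule: infinite_finite_induct)
    (auto simp: tensorial_at_zero[OF assms(1)] tensorial_at_plus[OF assms(1)] tensorial_at_fscale[OF assms(1)])

text \<open>The cutoff is 1 at \<open>p\<close>, so \<open>L\<close> takes the same value on
  \<open>X\<close> and on \<open>(\<rho> * \<rho> * \<rho>) \<odot> X\<close>; the latter is a
  combination whose coefficients vanish at \<open>p\<close>.\<close>

lemma tensorial_at_eq_0:
  assumes L: "tensorial_at p L" and X: "X \<in> VF" "X \<^bold>@ p = 0"
  shows "L X = 0"
proof -
  obtain \<rho> E where \<rho>: "\<rho> \<in> C" "\<rho> p = 1" and E: "\<And>b::'e. E b \<in> VF"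
    and *: "\<And>X. X \<in> VF \<Longrightarrow> \<exists>c. (\<forall>b. c b \<in> C) \<and> (X \<^bold>@ p = 0 \<longrightarrow> (\<forall>b. c b p = 0)) \<and>
        (\<rho> * \<rho> * \<rho>) \<odot> X = (\<Sum>b\<in>Basis. c b \<odot> E b)"
    by (rule cutoff_frame[of p]) blast
  from *[OF X(1)] X(2) obtain c where c: "\<And>b. c b \<in> C" "\<And>b. c b p = 0"
    "(\<rho> * \<rho> * \<rho>) \<odot> X = (\<Sum>b\<in>Basis. c b \<odot> E b)" by blast
  have "L X = L ((\<rho> * \<rho> * \<rho>) \<odot> X)"
    using L \<rho> X by (simp add: tensorial_at_fscale)
  also have "\<dots> = (\<Sum>b\<in>Basis. c b p * L (E b))"
    using L c E by (simp add: tensorial_at_sum)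
  finally show ?thesis using c by simp
qed

text \<open>Constant coefficients make the combination a global vector field, and its difference
  from \<open>X\<close> vanishes at \<open>p\<close>.\<close>

lemma tensorial_at_combination:
  assumes L: "tensorial_at p L" and X: "X \<in> VF" and e: "\<And>i. i \<in> I \<Longrightarrow> e i \<in> VF"
    and eq: "X \<^bold>@ p = (\<Sum>i\<in>I. tscale (c i) (e i \<^bold>@ p))"
  shows "L X = (\<Sum>i\<in>I. c i * L (e i))"
proof -
  let ?Y = "\<Sum>i\<in>I. (\<lambda>_. - c i) \<odot> e i"
  have Y: "?Y \<in> VF" using e by simp
  have "(X + ?Y) \<^bold>@ p = 0"
    using fun_cong[OF eq]
    by (simp add: fun_eq_iff value_at_def tscale_def fscale_def sum_fun_apply sum_negf)
  then have "L (X + ?Y) = 0" using tensorial_at_eq_0[OF L] X Y by simp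
  then show ?thesis
    using tensorial_at_plus[OF L X Y] tensorial_at_sum[OF L, of I "\<lambda>i _. - c i" e] e
    by (simp add: sum_negf)
qed

end

interpretation tvector: vector_space tscale
  by unfold_locales (auto simp: tscale_def fun_eq_iff algebra_simps)

text \<open>Coefficients are indexed by \<open>I\<close> rather than by the vectors, so the family
  may repeat; such combinations form a subspace containing every \<open>w i\<close>.\<close>

lemma tspan_imageD:
  assumes "finite I" "v \<in> tspan (w ` I)"
  obtains c where "v = (\<Sum>i\<in>I. tscale (c i) (w i))"
proof -
  have "v \<in> {v. \<exists>c. v = (\<Sum>i\<in>I. tscale (c i) (w i))}"
  proof (rule subsetD[OF tvector.span_minimal assms(2)])
    show "w ` I \<subseteq> {v. \<exists>c. v = (\<Sum>i\<in>I. tscale (c i) (w i))}"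
    proof clarify
      fix i assume "i \<in> I"
      then have "w i = (\<Sum>j\<in>I. tscale (if j = i then 1 else 0) (w j))"
        using assms(1) by (simp add: if_distrib[of "\<lambda>r. tscale r _"] sum.delta cong: if_cong)
      then show "\<exists>c. w i = (\<Sum>i\<in>I. tscale (c i) (w i))" by (rule exI[of _ "\<lambda>j. if j = i then 1 else 0"])
    qed
    show "tvector.subspace {v. \<exists>c. v = (\<Sum>i\<in>I. tscale (c i) (w i))}"
      unfolding tvector.subspace_def
    proof (intro conjI ballI allI)
      show "0 \<in> {v. \<exists>c. v = (\<Sum>i\<in>I. tscale (c i) (w i))}" by (auto intro!: exI[of _ "\<lambda>_. 0"])
      fix x assume "x \<in> {v. \<exists>c. v = (\<Sum>i\<in>I. tscale (c i) (w i))}"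
      then obtain a where a: "x = (\<Sum>i\<in>I. tscale (a i) (w i))" by auto
      show "tscale r x \<in> {v. \<exists>c. v = (\<Sum>i\<in>I. tscale (c i) (w i))}" for r
        using a by (auto simp: tvector.scale_sum_right intro!: exI[of _ "\<lambda>i. r * a i"])
      fix y assume "y \<in> {v. \<exists>c. v = (\<Sum>i\<in>I. tscale (c i) (w i))}"
      then obtain b where b: "y = (\<Sum>i\<in>I. tscale (b i) (w i))" by auto
      then show "x + y \<in> {v. \<exists>c. v = (\<Sum>i\<in>I. tscale (c i) (w i))}"
        using a by (auto simp: tvector.scale_left_distrib sum.distrib intro!: exI[of _ "\<lambda>i. a i + b i"])
    qed
  qed
  then show thesis using that by blast
qed

lemmas pointwise = plus_fun_apply times_fun_apply minus_apply uminus_apply zero_fun_apply one_fun_apply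

text \<open>Laws such as \<open>vf_plus\<close> have a variable at the head of their left-hand side; in their presence the
  simplifier turns sums of functions into pointwise lambda terms unless these rules are disabled.\<close>

declare pointwise [simp del]

lemma fscale_apply: "(f \<odot> X) h = f * X h"
  by (simp add: fscale_def)

lemma fscale_add_right: "f \<odot> (X + Y) = f \<odot> X + f \<odot> Y"
  and fscale_diff_right: "f \<odot> (X - Y) = f \<odot> X - f \<odot> Y"
  and fscale_minus_left: "(- f) \<odot> X = - (f \<odot> X)"
  and fscale_zero_left [simp]: "0 \<odot> X = 0"
  and fscale_zero_right [simp]: "f \<odot> 0 = 0"
  by (auto simp: fscale_def fun_eq_iff pointwise algebra_simps)

lemma fscale_sum_right: "f \<odot> (sum X I) = (\<Sum>i\<in>I. f \<odot> X i)"
  by (induction I rule: infinite_finite_induct)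
    (simp_all only: sum.infinite sum.empty sum.insert fscale_zero_right fscale_add_right if_True
      not_False_eq_True)

lemma lie_bracket_swap: "lie_bracket Y X = - lie_bracket X Y"
  by (simp add: lie_bracket_def fun_eq_iff pointwise)

context smooth_manifold
begin

lemma two_smooth [simp]: "2 \<in> C"
  by (metis one_add_one plus_smooth one_smooth)

lemma vf_ext:
  assumes "X \<in> VF" "Y \<in> VF" "\<And>f. f \<in> C \<Longrightarrow> X f = Y f"
  shows "X = Y"
  using assms vf_not_smooth by (metis ext)

text \<open>The maps \<open>\<phi>\<close>, \<open>\<eta> i\<close>, \<open>g\<close> and
  \<open>nab\<close> are known to be additive on vector fields only; this derives the usual
  consequences once for all of them.\<close>

lemma vf_additive:
  fixes L :: "'m vfield \<Rightarrow> 'z::ab_group_add"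
  assumes "\<And>X Y. X \<in> VF \<Longrightarrow> Y \<in> VF \<Longrightarrow> L (X + Y) = L X + L Y"
  shows "L 0 = 0" "X \<in> VF \<Longrightarrow> L (- X) = - L X"
    "X \<in> VF \<Longrightarrow> Y \<in> VF \<Longrightarrow> L (X - Y) = L X - L Y"
    "(\<And>i. i \<in> I \<Longrightarrow> Z i \<in> VF) \<Longrightarrow> L (sum Z I) = (\<Sum>i\<in>I. L (Z i))"
proof -
  show z: "L 0 = 0" using assms[of 0 0] by simp
  show m: "L (- X) = - L X" if "X \<in> VF" for X
    using assms[of X "- X"] z that by (simp add: eq_neg_iff_add_eq_0 add.commute)
  show "L (X - Y) = L X - L Y" if "X \<in> VF" "Y \<in> VF"
    using assms[of X "- Y"] m[of Y] that by simp
  show "L (sum Z I) = (\<Sum>i\<in>I. L (Z i))" if "\<And>i. i \<in> I \<Longrightarrow> Z i \<in> VF"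
    using that by (induction I rule: infinite_finite_induct) (auto simp: z assms)
qed

lemma lie_bracket_zero [simp]: "X \<in> VF \<Longrightarrow> lie_bracket 0 X = 0" "X \<in> VF \<Longrightarrow> lie_bracket X 0 = 0"
  by (simp_all add: lie_bracket_def fun_eq_iff pointwise)

lemma lie_bracket_add_left:
  assumes "X \<in> VF" "Y \<in> VF" "Z \<in> VF"
  shows "lie_bracket (X + Y) Z = lie_bracket X Z + lie_bracket Y Z"
proof (rule vf_ext)
  fix f assume "f \<in> C"
  with assms show "lie_bracket (X + Y) Z f = (lie_bracket X Z + lie_bracket Y Z) f"
    by (simp add: lie_bracket_def pointwise(1,3) vf_plus[OF assms(3)])
qed (use assms in simp_all)

lemma lie_bracket_fscale_left:
  assumes "f \<in> C" "X \<in> VF" "Y \<in> VF"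
  shows "lie_bracket (f \<odot> X) Y = f \<odot> lie_bracket X Y - Y f \<odot> X"
proof (rule vf_ext)
  fix h assume "h \<in> C"
  with assms show "lie_bracket (f \<odot> X) Y h = (f \<odot> lie_bracket X Y - Y f \<odot> X) h"
    by (simp add: lie_bracket_def pointwise(1,3) fscale_apply vf_times[OF assms(3)] algebra_simps)
qed (use assms in simp_all)

lemma lie_bracket_sum_left:
  assumes "\<And>i. i \<in> I \<Longrightarrow> X i \<in> VF" "Y \<in> VF"
  shows "lie_bracket (sum X I) Y = (\<Sum>i\<in>I. lie_bracket (X i) Y)"
  using vf_additive(4)[of "\<lambda>X. lie_bracket X Y" I X] lie_bracket_add_left assms by blast

lemma lie_bracket_uminus_right:
  assumes "X \<in> VF" "Y \<in> VF"
  shows "lie_bracket X (- Y) = - lie_bracket X Y"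
  using vf_additive(2)[of "\<lambda>Y. lie_bracket Y X" Y] lie_bracket_add_left assms
    lie_bracket_swap[of X] by metis

lemma jacobi:
  assumes "X \<in> VF" "Y \<in> VF" "Z \<in> VF"
  shows "lie_bracket X (lie_bracket Y Z) =
    lie_bracket (lie_bracket X Y) Z + lie_bracket Y (lie_bracket X Z)"
proof (rule vf_ext)
  fix f assume "f \<in> C"
  with assms show "lie_bracket X (lie_bracket Y Z) f =
      (lie_bracket (lie_bracket X Y) Z + lie_bracket Y (lie_bracket X Z)) f"
    by (simp add: lie_bracket_def pointwise(1,3) vf_minus[OF assms(1)] vf_minus[OF assms(2)] vf_minus[OF assms(3)])
qed (use assms in simp_all)

end

section \<open>Geometry of S-manifolds\<close>

locale S_geometry = smooth_manifold A
  for A :: "('m::{t2_space, second_countable_topology}, 'e::euclidean_space) chart set" +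
  fixes n s :: nat
    and \<phi> :: "'m vfield \<Rightarrow> 'm vfield"
    and \<xi> :: "nat \<Rightarrow> 'm vfield"
    and \<eta> :: "nat \<Rightarrow> 'm vfield \<Rightarrow> ('m \<Rightarrow> real)"
    and g :: "'m vfield \<Rightarrow> 'm vfield \<Rightarrow> ('m \<Rightarrow> real)"
    and nab :: "'m vfield \<Rightarrow> 'm vfield \<Rightarrow> 'm vfield"
  assumes S_mfd: "S_manifold A n s \<phi> \<xi> \<eta> g"
    and LC: "levi_civita_connection A g nab"
begin

lemma mf: "metric_f_manifold A n s \<phi> \<xi> \<eta> g"
  and s_pos: "0 < s"
  using S_mfd by (auto simp: S_manifold_def)

lemma phi_vf [simp]: "X \<in> VF \<Longrightarrow> \<phi> X \<in> VF"
  and phi_plus: "X \<in> VF \<Longrightarrow> Y \<in> VF \<Longrightarrow> \<phi> (X + Y) = \<phi> X + \<phi> Y"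
  and phi_fscale: "f \<in> C \<Longrightarrow> X \<in> VF \<Longrightarrow> \<phi> (f \<odot> X) = f \<odot> \<phi> X"
  using mf by (auto simp: metric_f_manifold_def endomorphism_field_def)

lemmas phi_zero [simp] = vf_additive(1)[of \<phi>, OF phi_plus]
lemmas phi_uminus = vf_additive(2)[of \<phi>, OF phi_plus]
lemmas phi_minus = vf_additive(3)[of \<phi>, OF phi_plus]
lemmas phi_sum = vf_additive(4)[of \<phi>, OF phi_plus]

lemma xi_vf [simp]: "i < s \<Longrightarrow> \<xi> i \<in> VF"
  using mf by (auto simp: metric_f_manifold_def)

lemma eta_smooth [simp]: "i < s \<Longrightarrow> X \<in> VF \<Longrightarrow> \<eta> i X \<in> C"
  and eta_plus: "i < s \<Longrightarrow> X \<in> VF \<Longrightarrow> Y \<in> VF \<Longrightarrow> \<eta> i (X + Y) = \<eta> i X + \<eta> i Y"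
  and eta_fscale: "i < s \<Longrightarrow> f \<in> C \<Longrightarrow> X \<in> VF \<Longrightarrow> \<eta> i (f \<odot> X) = f * \<eta> i X"
  using mf by (auto simp: metric_f_manifold_def one_form_def)

lemmas eta_uminus = vf_additive(2)[of "\<eta> i" for i, OF eta_plus]
lemmas eta_minus = vf_additive(3)[of "\<eta> i" for i, OF eta_plus]
lemmas eta_sum = vf_additive(4)[of "\<eta> i" for i, OF eta_plus]

lemma g_smooth [simp]: "X \<in> VF \<Longrightarrow> Y \<in> VF \<Longrightarrow> g X Y \<in> C"
  and g_plus_right: "X \<in> VF \<Longrightarrow> Y \<in> VF \<Longrightarrow> Z \<in> VF \<Longrightarrow> g X (Y + Z) = g X Y + g X Z"
  and g_fscale_right: "X \<in> VF \<Longrightarrow> f \<in> C \<Longrightarrow> Y \<in> VF \<Longrightarrow> g X (f \<odot> Y) = f * g X Y"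
  and g_sym: "X \<in> VF \<Longrightarrow> Y \<in> VF \<Longrightarrow> g X Y = g Y X"
  and g_pos: "X \<in> VF \<Longrightarrow> X \<^bold>@ p \<noteq> 0 \<Longrightarrow> 0 < g X X p"
  using mf by (auto simp: metric_f_manifold_def riemannian_metric_def one_form_def)

lemma g_plus_left: "X \<in> VF \<Longrightarrow> Y \<in> VF \<Longrightarrow> Z \<in> VF \<Longrightarrow> g (X + Y) Z = g X Z + g Y Z"
  and g_fscale_left: "X \<in> VF \<Longrightarrow> f \<in> C \<Longrightarrow> Y \<in> VF \<Longrightarrow> g (f \<odot> X) Y = f * g X Y"
  using g_sym[of Z "X + Y"] g_sym[of Z X] g_sym[of Z Y] g_sym[of Y "f \<odot> X"] g_sym[of Y X]
  by (simp_all add: g_plus_right g_fscale_right)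

lemmas g_zero_right [simp] = vf_additive(1)[of "g X" for X, OF g_plus_right]
lemmas g_uminus_right = vf_additive(2)[of "g X" for X, OF g_plus_right]
lemmas g_minus_right = vf_additive(3)[of "g X" for X, OF g_plus_right]
lemmas g_sum_right = vf_additive(4)[of "g X" for X, OF g_plus_right]
lemmas g_zero_left [simp] = vf_additive(1)[of "\<lambda>X. g X Z" for Z, OF g_plus_left]
lemmas g_uminus_left = vf_additive(2)[of "\<lambda>X. g X Z" for Z, OF g_plus_left]
lemmas g_minus_left = vf_additive(3)[of "\<lambda>X. g X Z" for Z, OF g_plus_left]
lemmas g_sum_left = vf_additive(4)[of "\<lambda>X. g X Z" for Z, OF g_plus_left]

lemma phi_ker: "X \<in> VF \<Longrightarrow> \<phi> X \<^bold>@ p = 0 \<longleftrightarrow> X \<^bold>@ p \<in> tspan ((\<lambda>i. \<xi> i \<^bold>@ p) ` {..<s})"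
  and eta_xi: "i < s \<Longrightarrow> j < s \<Longrightarrow> \<eta> i (\<xi> j) = (if i = j then 1 else 0)"
  and eta_phi [simp]: "i < s \<Longrightarrow> X \<in> VF \<Longrightarrow> \<eta> i (\<phi> X) = 0"
  and phi_phi: "X \<in> VF \<Longrightarrow> \<phi> (\<phi> X) = - X + (\<Sum>i<s. \<eta> i X \<odot> \<xi> i)"
  and g_phi_phi: "X \<in> VF \<Longrightarrow> Y \<in> VF \<Longrightarrow> g (\<phi> X) (\<phi> Y) = g X Y - (\<Sum>i<s. \<eta> i X * \<eta> i Y)"
  using mf by (auto simp: metric_f_manifold_def)

text \<open>The factor 2 is spelled out as a sum, which derivations split by additivity.\<close>

lemma ext_deriv_eta:
  "j < s \<Longrightarrow> X \<in> VF \<Longrightarrow> Y \<in> VF \<Longrightarrow> ext_deriv (\<eta> j) X Y = g X (\<phi> Y) + g X (\<phi> Y)"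
proof -
  assume "j < s" "X \<in> VF" "Y \<in> VF"
  then have "(\<lambda>p. 2 * g X (\<phi> Y) p) = ext_deriv (\<eta> j) X Y"
    using S_mfd by (auto simp: S_manifold_def fundamental_form_def)
  then show ?thesis unfolding fun_eq_iff pointwise by simp
qed

lemma normal: "X \<in> VF \<Longrightarrow> Y \<in> VF \<Longrightarrow> normality_tensor s \<phi> \<xi> \<eta> X Y = 0"
  using S_mfd by (auto simp: S_manifold_def)

lemma nab_vf [simp]: "X \<in> VF \<Longrightarrow> Y \<in> VF \<Longrightarrow> nab X Y \<in> VF"
  and nab_plus_left: "X \<in> VF \<Longrightarrow> Y \<in> VF \<Longrightarrow> Z \<in> VF \<Longrightarrow> nab (X + Y) Z = nab X Z + nab Y Z"
  and nab_fscale_left: "f \<in> C \<Longrightarrow> X \<in> VF \<Longrightarrow> Y \<in> VF \<Longrightarrow> nab (f \<odot> X) Y = f \<odot> nab X Y"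
  and nab_plus_right: "X \<in> VF \<Longrightarrow> Y \<in> VF \<Longrightarrow> Z \<in> VF \<Longrightarrow> nab X (Y + Z) = nab X Y + nab X Z"
  and nab_fscale_right: "f \<in> C \<Longrightarrow> X \<in> VF \<Longrightarrow> Y \<in> VF \<Longrightarrow> nab X (f \<odot> Y) = X f \<odot> Y + f \<odot> nab X Y"
  and torsion_free: "X \<in> VF \<Longrightarrow> Y \<in> VF \<Longrightarrow> lie_bracket X Y = nab X Y - nab Y X"
  and metric_compat: "X \<in> VF \<Longrightarrow> Y \<in> VF \<Longrightarrow> Z \<in> VF \<Longrightarrow> X (g Y Z) = g (nab X Y) Z + g Y (nab X Z)"
  using LC by (auto simp: levi_civita_connection_def endomorphism_field_def)

lemmas nab_zero_right [simp] = vf_additive(1)[of "nab X" for X, OF nab_plus_right]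
lemmas nab_uminus_right = vf_additive(2)[of "nab X" for X, OF nab_plus_right]
lemmas nab_minus_right = vf_additive(3)[of "nab X" for X, OF nab_plus_right]
lemmas nab_sum_right = vf_additive(4)[of "nab X" for X, OF nab_plus_right]
lemmas nab_uminus_left = vf_additive(2)[of "\<lambda>X. nab X Z" for Z, OF nab_plus_left]
lemmas nab_minus_left = vf_additive(3)[of "\<lambda>X. nab X Z" for Z, OF nab_plus_left]
lemmas nab_sum_left = vf_additive(4)[of "\<lambda>X. nab X Z" for Z, OF nab_plus_left]

lemma vf_eqI:
  assumes "X \<in> VF" "Y \<in> VF" "\<And>Z. Z \<in> VF \<Longrightarrow> g X Z = g Y Z"
  shows "X = Y"
proof -
  have "g (X - Y) (X - Y) = 0"
    using assms by (simp add: g_minus_left)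
  then have "(X - Y) \<^bold>@ p = 0" for p
    using g_pos[of "X - Y" p] assms by (force simp: pointwise)
  then show ?thesis by (simp add: value_at_def fun_eq_iff pointwise)
qed

lemma phi_xi [simp]: "i < s \<Longrightarrow> \<phi> (\<xi> i) = 0"
proof -
  assume i: "i < s"
  have "\<phi> (\<xi> i) \<^bold>@ p = 0" for p
    using i by (auto simp: phi_ker intro!: tvector.span_base)
  then show ?thesis by (simp add: value_at_def fun_eq_iff pointwise)
qed

lemma vertical_vf [simp]: "(\<And>i. i < s \<Longrightarrow> f i \<in> C) \<Longrightarrow> (\<Sum>i<s. f i \<odot> \<xi> i) \<in> VF"
  by (rule sum_vf) simp

text \<open>Putting Y = \<xi>_i into the compatibility of g and \<phi> makes its left-hand side
  vanish. Thus \<eta>_i is the metric dual of \<xi>_i.\<close>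

lemma g_xi_right: "i < s \<Longrightarrow> X \<in> VF \<Longrightarrow> g X (\<xi> i) = \<eta> i X"
proof -
  assume i: "i < s" and X: "X \<in> VF"
  have "(\<Sum>j<s. \<eta> j X * \<eta> j (\<xi> i)) = (\<Sum>j<s. if j = i then \<eta> i X else 0)"
    using i by (intro sum.cong) (auto simp: eta_xi)
  then show ?thesis
    using g_phi_phi[OF X xi_vf[OF i]] i X by simp
qed

lemma g_xi_left: "i < s \<Longrightarrow> X \<in> VF \<Longrightarrow> g (\<xi> i) X = \<eta> i X"
  using g_xi_right[of i X] g_sym[of X "\<xi> i"] by simp

lemma phi_eta_zeroI:
  assumes "X \<in> VF" "\<phi> X = 0" "\<And>i. i < s \<Longrightarrow> \<eta> i X = 0"
  shows "X = 0"
  using phi_phi[OF assms(1)] assms(2,3) by simp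

text \<open>Compatibility for \<open>X\<close> and \<open>\<phi> Y\<close> has no \<eta>-terms, and
  \<phi>^2 Y is -Y up to a vertical field, which is orthogonal to \<open>\<phi> X\<close>.\<close>

lemma phi_skew: "X \<in> VF \<Longrightarrow> Y \<in> VF \<Longrightarrow> g (\<phi> X) Y = - g X (\<phi> Y)"
proof -
  assume X: "X \<in> VF" and Y: "Y \<in> VF"
  have "g (\<phi> X) (\<Sum>i<s. \<eta> i Y \<odot> \<xi> i) = 0"
    using X Y by (subst g_sum_right) (simp_all add: g_fscale_right g_xi_right)
  then have "g (\<phi> X) (\<phi> (\<phi> Y)) = - g (\<phi> X) Y"
    using X Y by (simp add: phi_phi g_minus_right)
  moreover have "g (\<phi> X) (\<phi> (\<phi> Y)) = g X (\<phi> Y)"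
    using X Y by (simp add: g_phi_phi)
  ultimately show ?thesis by simp
qed

lemma g_phi_self: "X \<in> VF \<Longrightarrow> g X (\<phi> X) = 0"
  using phi_skew[of X X] g_sym[of X "\<phi> X"] by (simp add: fun_eq_iff pointwise)

section \<open>Invariance of the structure along the characteristic fields\<close>

lemma eta_bracket:
  "j < s \<Longrightarrow> X \<in> VF \<Longrightarrow> Y \<in> VF \<Longrightarrow>
    \<eta> j (lie_bracket X Y) = X (\<eta> j Y) - Y (\<eta> j X) - (g X (\<phi> Y) + g X (\<phi> Y))"
  by (simp add: ext_deriv_eta[symmetric] ext_deriv_def)

text \<open>The Lie derivative of \<eta>_j along \<xi>_i vanishes, because F(\<xi>_i, X) = 0 and
  \<eta>_j(\<xi>_i) is constant.\<close>

lemma eta_bracket_xi: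
  assumes "i < s" "j < s" "X \<in> VF"
  shows "\<eta> j (lie_bracket (\<xi> i) X) = \<xi> i (\<eta> j X)"
  using assms vf_zero[of X] vf_one[of X] by (simp add: eta_bracket eta_xi g_xi_left)

text \<open>In N(\<xi>_i, X) all terms with \<phi> \<xi>_i and the d\<eta>_j drop out. What remains
  says that the difference of the two sides lies in Ker \<phi>; every \<eta>_j kills it as well, so
  it is 0.\<close>

lemma bracket_xi_phi:
  assumes "i < s" "X \<in> VF"
  shows "lie_bracket (\<xi> i) (\<phi> X) = \<phi> (lie_bracket (\<xi> i) X)"
proof -
  have "\<phi> (\<phi> (lie_bracket (\<xi> i) X)) - \<phi> (lie_bracket (\<xi> i) (\<phi> X)) = 0"
    using normal[of "\<xi> i" X] assms
    by (simp add: normality_tensor_def nijenhuis_def ext_deriv_eta g_xi_left)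
  then have "\<phi> (\<phi> (lie_bracket (\<xi> i) X) - lie_bracket (\<xi> i) (\<phi> X)) = 0"
    using assms by (simp add: phi_minus)
  then have "\<phi> (lie_bracket (\<xi> i) X) - lie_bracket (\<xi> i) (\<phi> X) = 0"
    by (rule phi_eta_zeroI[rotated]) (use assms vf_zero in \<open>simp_all add: eta_minus eta_bracket_xi\<close>)
  then show ?thesis by simp
qed

text \<open>\<open>2F = d\<eta>\<^sub>i\<close> and \<open>d\<^sup>2 = 0\<close>, so \<open>L\<^bsub>\<xi>\<^esub>F = d(\<iota>\<^bsub>\<xi>\<^esub>F) = 0\<close>; with \<open>L\<^bsub>\<xi>\<^esub>\<phi> = 0\<close> this makes \<open>\<xi>\<^sub>i\<close> Killing.\<close>

lemma xi_derivative_fundamental: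
  assumes i: "i < s" and X: "X \<in> VF" and Y: "Y \<in> VF"
  shows "\<xi> i (g X (\<phi> Y)) = g (lie_bracket (\<xi> i) X) (\<phi> Y) + g X (\<phi> (lie_bracket (\<xi> i) Y))"
proof -
  let ?w = "\<eta> i" and ?x = "\<xi> i"
  have xi: "?x \<in> VF" using i by simp
  have F: "g U (\<phi> V) + g U (\<phi> V) = U (?w V) - V (?w U) - ?w (lie_bracket U V)"
    if "U \<in> VF" "V \<in> VF" for U V
    using eta_bracket[OF i that] by simp
  \<comment> \<open>Facts \<open>1\<close> to \<open>3\<close> expand 2F = d\<eta>_i for the three
    terms of the claim. Their second derivatives cancel by the definition of the bracket, and d^2 =
    0 appears as the Jacobi identity in \<open>4\<close>.\<close>
  have 1: "?x (g X (\<phi> Y)) + ?x (g X (\<phi> Y)) =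
      ?x (X (?w Y)) - ?x (Y (?w X)) - ?w (lie_bracket ?x (lie_bracket X Y))"
  proof -
    have "?x (g X (\<phi> Y)) + ?x (g X (\<phi> Y)) = ?x (g X (\<phi> Y) + g X (\<phi> Y))"
      using X Y xi by (intro vf_plus[symmetric]) simp_all
    also have "\<dots> = ?x (X (?w Y)) - ?x (Y (?w X)) - ?x (?w (lie_bracket X Y))"
      unfolding F[OF X Y] using X Y i xi by (simp add: vf_minus[OF xi])
    finally show ?thesis using X Y i by (simp add: eta_bracket_xi)
  qed
  have 2: "g (lie_bracket ?x X) (\<phi> Y) + g (lie_bracket ?x X) (\<phi> Y) =
      lie_bracket ?x X (?w Y) - Y (?x (?w X)) - ?w (lie_bracket (lie_bracket ?x X) Y)"
    using X Y xi i by (simp add: F eta_bracket_xi)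
  have 3: "g X (\<phi> (lie_bracket ?x Y)) + g X (\<phi> (lie_bracket ?x Y)) =
      X (?x (?w Y)) - lie_bracket ?x Y (?w X) - ?w (lie_bracket X (lie_bracket ?x Y))"
    using X Y xi i by (simp add: F eta_bracket_xi)
  have 4: "?w (lie_bracket ?x (lie_bracket X Y)) =
      ?w (lie_bracket (lie_bracket ?x X) Y) + ?w (lie_bracket X (lie_bracket ?x Y))"
    using X Y xi i by (subst jacobi) (simp_all add: eta_plus)
  have br: "lie_bracket U V f = U (V f) - V (U f)" for U V :: "'m vfield" and f
    by (simp add: lie_bracket_def)
  show ?thesis
  proof
    fix p
    show "?x (g X (\<phi> Y)) p = (g (lie_bracket ?x X) (\<phi> Y) + g X (\<phi> (lie_bracket ?x Y))) p"
      using fun_cong[OF 1, of p] fun_cong[OF 2, of p] fun_cong[OF 3, of p] fun_cong[OF 4, of p]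
        fun_cong[OF br[of ?x X "?w Y"], of p] fun_cong[OF br[of ?x Y "?w X"], of p] by (simp add: pointwise)
  qed
qed

text \<open>g(X, Y) is F(\<phi> X, Y) plus the sum of \<eta>_j(X) \<eta>_j(Y), and F, \<phi> and all
  \<eta>_j are invariant along \<xi>_i.\<close>

lemma xi_killing:
  assumes i: "i < s" and X: "X \<in> VF" and Y: "Y \<in> VF"
  shows "\<xi> i (g X Y) = g (lie_bracket (\<xi> i) X) Y + g X (lie_bracket (\<xi> i) Y)"
proof -
  let ?x = "\<xi> i"
  have g: "g U V = g (\<phi> U) (\<phi> V) + (\<Sum>j<s. \<eta> j U * \<eta> j V)" if "U \<in> VF" "V \<in> VF" for U V
    using g_phi_phi[OF that] by simp
  have sm: "(\<Sum>j<s. \<eta> j X * \<eta> j Y) \<in> C"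
    using X Y by (intro sum_smooth times_smooth eta_smooth) simp_all
  have "?x (g X Y) = ?x (g (\<phi> X) (\<phi> Y)) + (\<Sum>j<s. \<eta> j X * ?x (\<eta> j Y) + \<eta> j Y * ?x (\<eta> j X))"
  proof -
    have "?x (\<Sum>j<s. \<eta> j X * \<eta> j Y) = (\<Sum>j<s. ?x (\<eta> j X * \<eta> j Y))"
      using X Y i by (intro vf_sum) simp_all
    also have "\<dots> = (\<Sum>j<s. \<eta> j X * ?x (\<eta> j Y) + \<eta> j Y * ?x (\<eta> j X))"
      using X Y i by (intro sum.cong vf_times) simp_all
    finally show ?thesis
      unfolding g[OF X Y] using X Y i sm by (simp add: vf_plus[OF xi_vf])
  qed
  also have "?x (g (\<phi> X) (\<phi> Y)) = g (\<phi> (lie_bracket ?x X)) (\<phi> Y) + g (\<phi> X) (\<phi> (lie_bracket ?x Y))"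
    using X Y i by (simp add: xi_derivative_fundamental bracket_xi_phi)
  finally show ?thesis
    using X Y i g[of "lie_bracket ?x X" Y] g[of X "lie_bracket ?x Y"]
    by (simp add: eta_bracket_xi sum.distrib mult.commute algebra_simps)
qed

text \<open>The bilinear form g(\<nabla>_X \<xi>_i, Y) is known from its two parts: fact
  \<open>1\<close> says that its antisymmetric part is F, fact \<open>2\<close>, the Killing
  equation, that its symmetric part is 0.\<close>

lemma nab_xi:
  assumes i: "i < s" and X: "X \<in> VF"
  shows "nab X (\<xi> i) = - \<phi> X"
proof (rule vf_eqI)
  fix Y assume Y: "Y \<in> VF"
  let ?x = "\<xi> i"
  have x: "?x \<in> VF" using i by simp
  have e: "\<eta> i Z = g Z ?x" if "Z \<in> VF" for Z using g_xi_right[OF i that] by simp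
  have 1: "g (nab X Y - nab Y X) ?x = X (g Y ?x) - Y (g X ?x) - (g X (\<phi> Y) + g X (\<phi> Y))"
    using eta_bracket[OF i X Y] X Y x by (simp add: e torsion_free)
  have 2: "?x (g X Y) = g (nab ?x X - nab X ?x) Y + g X (nab ?x Y - nab Y ?x)"
    using xi_killing[OF i X Y] X Y x by (simp add: torsion_free)
  have sk: "g (\<phi> X) Y = - g X (\<phi> Y)" using X Y by (rule phi_skew)
  show "g (nab X ?x) Y = g (- \<phi> X) Y"
  proof
    fix p
    show "g (nab X ?x) Y p = g (- \<phi> X) Y p"
      using fun_cong[OF 1, of p] fun_cong[OF 2, of p] X Y x sk g_sym[of X "nab Y ?x"] g_sym[of Y "nab X ?x"]
      by (simp add: metric_compat[OF x] metric_compat[OF X] metric_compat[OF Y] g_minus_left g_minus_right g_uminus_left pointwise)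
  qed
qed (use i X in simp_all)

lemma nab_xi_left: "i < s \<Longrightarrow> X \<in> VF \<Longrightarrow> nab (\<xi> i) X = lie_bracket (\<xi> i) X - \<phi> X"
  by (simp add: torsion_free nab_xi)

subsection \<open>Curvature\<close>

abbreviation "R \<equiv> curvature nab"

lemma curvature_vf [simp]: "X \<in> VF \<Longrightarrow> Y \<in> VF \<Longrightarrow> Z \<in> VF \<Longrightarrow> R X Y Z \<in> VF"
  by (simp add: curvature_def)

lemma curvature_skew: "X \<in> VF \<Longrightarrow> Y \<in> VF \<Longrightarrow> Z \<in> VF \<Longrightarrow> R Y X Z = - R X Y Z"
  by (simp add: curvature_def lie_bracket_swap[of Y X] nab_uminus_left)

lemma curvature_skew_right:
  assumes X: "X \<in> VF" and Y: "Y \<in> VF" and Z: "Z \<in> VF" and W: "W \<in> VF"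
  shows "g (R X Y Z) W = - g (R X Y W) Z"
proof -
  have 2: "U (V (g Z W)) = g (nab U (nab V Z)) W + g (nab V Z) (nab U W)
      + (g (nab U Z) (nab V W) + g Z (nab U (nab V W)))" if U: "U \<in> VF" and V: "V \<in> VF" for U V
    using that Z W by (simp add: metric_compat[OF V] metric_compat[OF U] vf_plus[OF U])
  have 3: "X (Y (g Z W)) - Y (X (g Z W)) = lie_bracket X Y (g Z W)"
    by (simp add: lie_bracket_def)
  show ?thesis
  proof
    fix p
    show "g (R X Y Z) W p = (- g (R X Y W) Z) p"
      using fun_cong[OF 3, of p] assms g_sym[of Z "nab X (nab Y W)"] g_sym[of Z "nab Y (nab X W)"]
        g_sym[of Z "nab (lie_bracket X Y) W"]
      by (simp add: 2[OF X Y] 2[OF Y X] metric_compat[OF lie_bracket_vf[OF X Y]] curvature_def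
          g_minus_left pointwise)
  qed
qed

lemma bianchi:
  assumes X: "X \<in> VF" and Y: "Y \<in> VF" and Z: "Z \<in> VF"
  shows "R X Y Z + R Y Z X + R Z X Y = 0"
proof -
  have "R X Y Z + R Y Z X + R Z X Y =
    lie_bracket X (lie_bracket Y Z) + lie_bracket Y (lie_bracket Z X) + lie_bracket Z (lie_bracket X Y)"
    using assms by (simp add: curvature_def torsion_free nab_minus_right nab_minus_left algebra_simps)
  also have "\<dots> = 0"
    unfolding jacobi[OF X Y Z] lie_bracket_swap[of Z X] lie_bracket_swap[of Z "lie_bracket X Y"]
      lie_bracket_uminus_right[OF Y lie_bracket_vf[OF X Z]] by simp
  finally show ?thesis .
qed

text \<open>The octahedron argument: four Bianchi identities for the same four fields, reduced by
  the two skew symmetries.\<close>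

lemma curvature_pair_sym:
  assumes X: "X \<in> VF" and Y: "Y \<in> VF" and Z: "Z \<in> VF" and W: "W \<in> VF"
  shows "g (R X Y Z) W = g (R Z W X) Y"
proof
  fix p
  let ?r = "\<lambda>X Y Z W. g (R X Y Z) W p"
  have b: "?r A B E F + ?r B E A F + ?r E A B F = 0" if "A \<in> VF" "B \<in> VF" "E \<in> VF" "F \<in> VF" for A B E F
  proof -
    have "g (R A B E + R B E A + R E A B) F p = 0" using bianchi that by (simp add: pointwise)
    then show ?thesis using that by (simp add: g_plus_left pointwise)
  qed
  have k: "?r B A E F = - ?r A B E F" if "A \<in> VF" "B \<in> VF" "E \<in> VF" "F \<in> VF" for A B E F
    using curvature_skew[of A B E] that by (simp add: g_uminus_left pointwise)
  have l: "?r A B F E = - ?r A B E F" if "A \<in> VF" "B \<in> VF" "E \<in> VF" "F \<in> VF" for A B E F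
    using curvature_skew_right[of A B F E] that by (simp add: pointwise)
  show "?r X Y Z W = ?r Z W X Y"
    using b[OF X Y Z W] b[OF Y Z W X] b[OF Z W X Y] b[OF W X Y Z]
      k[OF X Y Z W] k[OF X Y W Z] k[OF Y Z X W] k[OF Y Z W X] k[OF Z W X Y] k[OF Z W Y X]
      k[OF W X Y Z] k[OF W X Z Y] k[OF X Z Y W] k[OF X Z W Y] k[OF Y W X Z] k[OF Y W Z X]
      l[OF X Y Z W] l[OF Y Z X W] l[OF Z W X Y] l[OF W X Y Z] l[OF X Z Y W] l[OF Y W X Z]
    by linarith
qed

lemma curvature_add: "X \<in> VF \<Longrightarrow> X' \<in> VF \<Longrightarrow> Y \<in> VF \<Longrightarrow> Z \<in> VF \<Longrightarrow> R (X + X') Y Z = R X Y Z + R X' Y Z"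
  by (simp add: curvature_def nab_plus_left nab_plus_right lie_bracket_add_left algebra_simps)

lemma curvature_fscale: "f \<in> C \<Longrightarrow> X \<in> VF \<Longrightarrow> Y \<in> VF \<Longrightarrow> Z \<in> VF \<Longrightarrow> R (f \<odot> X) Y Z = f \<odot> R X Y Z"
  by (simp add: curvature_def nab_fscale_left nab_fscale_right lie_bracket_fscale_left nab_minus_left
      fscale_diff_right fscale_add_right algebra_simps)

text \<open>Only the first slot is computed. The second follows by skew symmetry and the third by
  pair symmetry, which avoids second derivatives of the coefficient.\<close>

lemma curvature_tensorial:
  assumes "X \<in> VF" "Y \<in> VF" "Z \<in> VF"
  shows "tensorial_at p (\<lambda>W. g (R W X Y) Z p)" "tensorial_at p (\<lambda>W. g (R X W Y) Z p)"
    "tensorial_at p (\<lambda>W. g (R X Y W) Z p)" "tensorial_at p (\<lambda>W. g (R X Y Z) W p)"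
proof -
  have 1: "tensorial_at p (\<lambda>W. g (R W X Y) Z p)" if "X \<in> VF" "Y \<in> VF" "Z \<in> VF" for X Y Z
    by (rule tensorial_atI)
      (use that in \<open>simp_all add: curvature_add curvature_fscale g_plus_left g_fscale_left pointwise\<close>)
  then show "tensorial_at p (\<lambda>W. g (R W X Y) Z p)" using assms by blast
  have eq: "g (R X W Y) Z p = - g (R W X Y) Z p" if "W \<in> VF" for W
    using curvature_skew[of W X Y] assms that by (simp add: g_uminus_left pointwise)
  show "tensorial_at p (\<lambda>W. g (R X W Y) Z p)"
    using 1[OF assms] eq assms unfolding tensorial_at_def by simp
  show "tensorial_at p (\<lambda>W. g (R X Y W) Z p)"
    using 1[OF assms(3,1,2)] curvature_pair_sym[of _ Z X Y] assms unfolding tensorial_at_def by simp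
  show "tensorial_at p (\<lambda>W. g (R X Y Z) W p)"
    by (rule tensorial_atI) (use assms in \<open>simp_all add: g_plus_right g_fscale_right pointwise\<close>)
qed

lemma curvature_xi_xi:
  assumes "i < s" "j < s" "X \<in> VF"
  shows "R X (\<xi> i) (\<xi> j) = - \<phi> (\<phi> X)"
  using assms
  by (simp add: curvature_def nab_xi nab_uminus_right nab_xi_left bracket_xi_phi
      lie_bracket_swap[of X "\<xi> i"] phi_uminus)

section \<open>The covariant derivative of the structure endomorphism\<close>

definition nab_phi :: "'m vfield \<Rightarrow> 'm vfield \<Rightarrow> 'm vfield" where
  "nab_phi X Y = nab X (\<phi> Y) - \<phi> (nab X Y)"

lemma nab_phi_vf [simp]: "X \<in> VF \<Longrightarrow> Y \<in> VF \<Longrightarrow> nab_phi X Y \<in> VF"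
  by (simp add: nab_phi_def)

lemma nab_phi_xi_left: "i < s \<Longrightarrow> X \<in> VF \<Longrightarrow> nab_phi (\<xi> i) X = 0"
  by (simp add: nab_phi_def nab_xi_left bracket_xi_phi phi_minus)

lemma nab_phi_xi_right: "i < s \<Longrightarrow> X \<in> VF \<Longrightarrow> nab_phi X (\<xi> i) = \<phi> (\<phi> X)"
  by (simp add: nab_phi_def nab_xi phi_uminus)

lemma curvature_xi:
  assumes "i < s" "X \<in> VF" "Y \<in> VF"
  shows "R X Y (\<xi> i) = nab_phi Y X - nab_phi X Y"
  using assms
  by (simp add: curvature_def nab_phi_def nab_xi nab_uminus_right torsion_free phi_minus)

lemma nab_phi_skew:
  assumes X: "X \<in> VF" and Y: "Y \<in> VF" and Z: "Z \<in> VF"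
  shows "g (nab_phi X Y) Z = - g (nab_phi X Z) Y"
proof -
  have 1: "X (g (\<phi> Y) Z) = - X (g Y (\<phi> Z))"
    using assms by (simp add: phi_skew vf_uminus[OF X])
  show ?thesis
  proof
    fix p
    show "g (nab_phi X Y) Z p = (- g (nab_phi X Z) Y) p"
      using fun_cong[OF 1, of p] assms g_sym[of Y "nab X (\<phi> Z)"] g_sym[of "\<phi> Y" "nab X Z"]
        phi_skew[of "nab X Y" Z] phi_skew[of "nab X Z" Y]
      by (simp add: nab_phi_def metric_compat[OF X] g_minus_left pointwise)
  qed
qed

text \<open>This is dF = 0, read off from the Bianchi identity paired with \<xi>_0: by
  \<open>curvature_xi\<close> each term is a difference of two values of \<open>nab_phi\<close>, and
  skewness gathers the six into -2 times the cyclic sum.\<close>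

lemma nab_phi_cyclic:
  assumes X: "X \<in> VF" and Y: "Y \<in> VF" and Z: "Z \<in> VF"
  shows "g (nab_phi X Y) Z p + g (nab_phi Y Z) X p + g (nab_phi Z X) Y p = 0"
proof -
  let ?x = "\<xi> 0"
  have x: "?x \<in> VF" using s_pos by simp
  have "g (R X Y Z + R Y Z X + R Z X Y) ?x p = 0" using bianchi[OF X Y Z] x by (simp add: pointwise)
  then have "g (R X Y ?x) Z p + g (R Y Z ?x) X p + g (R Z X ?x) Y p = 0"
    using assms x curvature_skew_right[of X Y Z ?x] curvature_skew_right[of Y Z X ?x]
      curvature_skew_right[of Z X Y ?x] by (simp add: g_plus_left pointwise)
  then show ?thesis
    using assms s_pos fun_cong[OF nab_phi_skew[of X Y Z], of p] fun_cong[OF nab_phi_skew[of Y Z X], of p]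
      fun_cong[OF nab_phi_skew[of Z X Y], of p]
    by (simp add: curvature_xi g_minus_left pointwise)
qed

lemma nijenhuis_nab_phi:
  assumes "X \<in> VF" "Y \<in> VF"
  shows "nijenhuis \<phi> X Y =
    nab_phi (\<phi> X) Y - nab_phi (\<phi> Y) X - \<phi> (nab_phi X Y) + \<phi> (nab_phi Y X)"
  using assms by (simp add: nijenhuis_def nab_phi_def torsion_free phi_minus algebra_simps)

abbreviation "DD \<equiv> sections_D A s \<eta>"

lemma D_vf [simp]: "X \<in> DD \<Longrightarrow> X \<in> VF" and D_eta [simp]: "X \<in> DD \<Longrightarrow> i < s \<Longrightarrow> \<eta> i X = 0"
  by (auto simp: sections_D_def)

lemma D_I: "X \<in> VF \<Longrightarrow> (\<And>i. i < s \<Longrightarrow> \<eta> i X = 0) \<Longrightarrow> X \<in> DD"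
  unfolding sections_D_def by blast

lemma phi_D [simp]: "X \<in> VF \<Longrightarrow> \<phi> X \<in> DD"
  by (rule D_I) auto

lemma phi_phi_D: "X \<in> DD \<Longrightarrow> \<phi> (\<phi> X) = - X"
  by (simp add: phi_phi)

text \<open>The transverse structure is Kaehler: \<open>\<beta>(X, Y, Z) = g((\<nabla>\<^bsub>\<phi>X\<^esub>\<phi>)Y, Z)\<close> satisfies
  \<open>\<beta>(X, Y, Z) + \<beta>(Y, Z, X) = \<beta>(Z, X, Y)\<close> by normality and closedness of \<open>F\<close>; adding the cyclically
  permuted identity gives \<open>\<beta> = 0\<close>.\<close>

lemma nab_phi_D:
  assumes X: "X \<in> DD" and Y: "Y \<in> DD" and Z: "Z \<in> DD"
  shows "g (nab_phi X Y) Z p = 0"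
proof -
  let ?b = "\<lambda>X Y Z. g (nab_phi (\<phi> X) Y) Z p"
  have rel: "?b U V W + ?b V W U = ?b W U V" if U: "U \<in> DD" and V: "V \<in> DD" and W: "W \<in> DD" for U V W
  proof -
    note vf = D_vf[OF U] D_vf[OF V] D_vf[OF W]
    have "g (nijenhuis \<phi> U V + (\<Sum>i<s. ext_deriv (\<eta> i) U V \<odot> \<xi> i)) W p = 0"
      using normal[of U V] vf by (simp add: normality_tensor_def pointwise)
    moreover have "g (\<Sum>i<s. ext_deriv (\<eta> i) U V \<odot> \<xi> i) W = 0"
      using vf W by (subst g_sum_left) (simp_all add: ext_deriv_eta g_fscale_left g_xi_left)
    moreover have "(\<Sum>i<s. ext_deriv (\<eta> i) U V \<odot> \<xi> i) \<in> VF" using vf by (simp add: ext_deriv_eta)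
    moreover have "nijenhuis \<phi> U V \<in> VF" using vf by (simp add: nijenhuis_def)
    ultimately have "g (nijenhuis \<phi> U V) W p = 0"
      by (simp add: g_plus_left vf pointwise)
    then have "?b U V W - ?b V U W + g (nab_phi U V) (\<phi> W) p - g (nab_phi V U) (\<phi> W) p = 0"
      using vf by (simp add: nijenhuis_nab_phi g_minus_left g_plus_left phi_skew pointwise)
    \<comment> \<open>The cyclic identity for \<open>U\<close>, \<open>V\<close>,
      \<open>\<phi> W\<close> replaces the two terms paired with \<open>\<phi> W\<close> by the
      single term \<open>?b W U V\<close> up to sign; skewness brings the rest into cyclic
      order.\<close>
    then show ?thesis
      using vf fun_cong[OF nab_phi_skew[of "\<phi> V" U W], of p] fun_cong[OF nab_phi_skew[of V "\<phi> W" U], of p]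
        nab_phi_cyclic[of U V "\<phi> W" p] by (simp add: pointwise)
  qed
  \<comment> \<open>The first slot is \<open>\<phi> X\<close> because \<phi>^2 X = -X then gives
    back \<open>nab_phi X\<close> up to sign.\<close>
  have "?b (\<phi> X) Y Z = 0"
    using rel[of "\<phi> X" Y Z] rel[of Z "\<phi> X" Y] X Y Z by simp
  then show ?thesis
    using X Y Z by (simp add: phi_phi_D nab_phi_def nab_uminus_left phi_uminus g_minus_left g_uminus_left pointwise)
qed

end

lemma sum_lessThan_add:
  fixes f :: "nat \<Rightarrow> 'a::comm_monoid_add"
  shows "sum f {..<m + n} = sum f {..<m} + (\<Sum>i<n. f (m + i))"
  by (induction n) (simp_all add: add.assoc)

context S_geometry
begin

subsection \<open>Orthonormal bases and traces\<close>

lemma g_tensorial: "Y \<in> VF \<Longrightarrow> tensorial_at p (\<lambda>X. g X Y p)"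
  by (rule tensorial_atI) (simp_all add: g_plus_left g_fscale_left pointwise)

text \<open>Pairing with \<open>e b\<close> is itself tensorial, so it identifies the coefficients
  of \<open>X\<close> at \<open>p\<close>; these serve for every \<open>L\<close>.\<close>

lemma orthonormal_expansion:
  assumes e: "orthonormal_basis_at g \<Gamma> k p e" and \<Gamma>: "\<Gamma> \<subseteq> VF" and X: "X \<in> \<Gamma>" and L: "tensorial_at p L"
  shows "L X = (\<Sum>a<k. g X (e a) p * L (e a))"
proof -
  have eV: "e a \<in> VF" if "a < k" for a using e \<Gamma> that by (auto simp: orthonormal_basis_at_def)
  have "X \<^bold>@ p \<in> tspan ((\<lambda>a. e a \<^bold>@ p) ` {..<k})" using e X by (auto simp: orthonormal_basis_at_def)
  then obtain c where c: "X \<^bold>@ p = (\<Sum>a<k. tscale (c a) (e a \<^bold>@ p))"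
    by (rule tspan_imageD[OF finite_lessThan])
  have comb: "L' X = (\<Sum>a<k. c a * L' (e a))" if "tensorial_at p L'" for L'
    by (rule tensorial_at_combination[OF that _ _ c]) (use X \<Gamma> eV in auto)
  have "g X (e b) p = c b" if b: "b < k" for b
  proof -
    have "g X (e b) p = (\<Sum>a<k. c a * g (e a) (e b) p)"
      by (rule comb[OF g_tensorial[OF eV[OF b]]])
    also have "\<dots> = (\<Sum>a<k. if a = b then c b else 0)"
      using e b by (intro sum.cong) (auto simp: orthonormal_basis_at_def)
    finally show ?thesis using b by simp
  qed
  then show ?thesis using comb[OF L] by simp
qed

text \<open>Expand \<open>e' b\<close> in the basis \<open>e\<close> in the first slot only; after
  exchanging the sums, the second slot reassembles \<open>e a\<close> from the basis
  \<open>e'\<close>.\<close>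

lemma trace_independent:
  assumes e: "orthonormal_basis_at g VF k p e" and e': "orthonormal_basis_at g VF k p e'"
    and Q1: "\<And>Y. Y \<in> VF \<Longrightarrow> tensorial_at p (\<lambda>X. Q X Y)"
    and Q2: "\<And>X. X \<in> VF \<Longrightarrow> tensorial_at p (\<lambda>Y. Q X Y)"
  shows "(\<Sum>a<k. Q (e a) (e a)) = (\<Sum>a<k. Q (e' a) (e' a))"
proof -
  have V: "e a \<in> VF" "e' a \<in> VF" if "a < k" for a
    using e e' that by (auto simp: orthonormal_basis_at_def)
  have "(\<Sum>b<k. Q (e' b) (e' b)) = (\<Sum>b<k. \<Sum>a<k. g (e' b) (e a) p * Q (e a) (e' b))"
    by (intro sum.cong orthonormal_expansion[OF e subset_refl] Q1 V) auto
  also have "\<dots> = (\<Sum>a<k. \<Sum>b<k. g (e' b) (e a) p * Q (e a) (e' b))"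
    by (rule sum.swap)
  also have "\<dots> = (\<Sum>a<k. \<Sum>b<k. g (e a) (e' b) p * Q (e a) (e' b))"
    by (intro sum.cong refl) (use g_sym V in auto)
  also have "\<dots> = (\<Sum>a<k. Q (e a) (e a))"
    by (intro sum.cong refl orthonormal_expansion[OF e' subset_refl, symmetric] Q2 V) auto
  finally show ?thesis by simp
qed

lemma fscale_D [simp]: "f \<in> C \<Longrightarrow> X \<in> DD \<Longrightarrow> f \<odot> X \<in> DD"
  and minus_D [simp]: "X \<in> DD \<Longrightarrow> Y \<in> DD \<Longrightarrow> X - Y \<in> DD"
  by (rule D_I; simp add: eta_fscale eta_minus)+

lemma sum_D [simp]: "(\<And>i. i \<in> I \<Longrightarrow> X i \<in> DD) \<Longrightarrow> sum X I \<in> DD"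
  by (rule D_I) (simp_all add: eta_sum)

lemma value_at_fscale: "(f \<odot> X) \<^bold>@ p = tscale (f p) (X \<^bold>@ p)"
  and value_at_minus: "(X - Y) \<^bold>@ p = X \<^bold>@ p - Y \<^bold>@ p"
  and value_at_add: "(X + Y) \<^bold>@ p = X \<^bold>@ p + Y \<^bold>@ p"
  and value_at_sum: "(sum Z I) \<^bold>@ p = (\<Sum>i\<in>I. Z i \<^bold>@ p)"
  by (auto simp: value_at_def fscale_def tscale_def fun_eq_iff sum_fun_apply pointwise)

lemma orthonormal_D_step:
  fixes k :: nat
  assumes e: "\<And>a. a < k \<Longrightarrow> e a \<in> DD"
    "\<And>a b. a < k \<Longrightarrow> b < k \<Longrightarrow> g (e a) (e b) p = (if a = b then 1 else 0)"
    and X: "X \<in> DD" "X \<^bold>@ p \<notin> tspan ((\<lambda>a. e a \<^bold>@ p) ` {..<k})"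
  obtains Y where "Y \<in> DD" "\<And>a. a < k \<Longrightarrow> g (e a) Y p = 0" "g Y Y p = 1"
    "Y \<^bold>@ p \<notin> tspan ((\<lambda>a. e a \<^bold>@ p) ` {..<k})"
proof -
  let ?S = "tspan ((\<lambda>a. e a \<^bold>@ p) ` {..<k})"
  \<comment> \<open>Gram-Schmidt with coefficients frozen at \<open>p\<close>, where alone
    orthonormality is asked.\<close>
  define W where "W = (\<Sum>a<k. (\<lambda>_. g X (e a) p) \<odot> e a)"
  have W: "W \<in> DD" using e unfolding W_def by (intro sum_D fscale_D) auto
  have WS: "W \<^bold>@ p \<in> ?S"
    unfolding W_def value_at_sum value_at_fscale
    by (intro tvector.span_sum tvector.span_scale tvector.span_base) auto
  have XW: "(X - W) \<^bold>@ p \<notin> ?S"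
    using X(2) tvector.span_add[OF _ WS, of "X \<^bold>@ p - W \<^bold>@ p"] by (auto simp: value_at_minus)
  have c: "0 < g (X - W) (X - W) p"
    using XW tvector.span_zero[of "(\<lambda>a. e a \<^bold>@ p) ` {..<k}"] X W by (intro g_pos) auto
  define r where "r = 1 / sqrt (g (X - W) (X - W) p)"
  have r: "r \<noteq> 0" "r * (r * g (X - W) (X - W) p) = 1"
    using c by (auto simp: r_def field_simps)
  define Y where "Y = (\<lambda>_. r) \<odot> (X - W)"
  have orth: "g (e b) (X - W) p = 0" if b: "b < k" for b
  proof -
    have "g W (e b) p = (\<Sum>a<k. g X (e a) p * g (e a) (e b) p)"
      unfolding W_def by (rule tensorial_at_sum[OF g_tensorial]) (use e b in auto)
    also have "\<dots> = (\<Sum>a<k. if a = b then g X (e b) p else 0)"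
      using b e(2) by (intro sum.cong) auto
    finally have "g W (e b) p = g X (e b) p" using b by simp
    moreover have "g (e b) (X - W) = g X (e b) - g W (e b)"
      using e(1)[OF b] X W by (simp add: g_minus_right g_sym[of "e b"])
    ultimately show ?thesis by (simp add: pointwise)
  qed
  show thesis
  proof
    show "Y \<in> DD" using X W by (simp add: Y_def)
    show "g (e a) Y p = 0" if "a < k" for a
      using orth[OF that] e(1)[OF that] X W by (simp add: Y_def g_fscale_right pointwise)
    show "g Y Y p = 1"
      using X W r by (simp add: Y_def g_fscale_right g_fscale_left pointwise)
    show "Y \<^bold>@ p \<notin> ?S"
    proof
      assume "Y \<^bold>@ p \<in> ?S"
      then have "tscale (1 / r) (Y \<^bold>@ p) \<in> ?S" by (rule tvector.span_scale)
      then show False using XW r by (simp add: Y_def value_at_fscale)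
    qed
  qed
qed

text \<open>On D one has X = \<phi>(-\<phi> X), so the fibre of D is the image of \<phi>, of
  dimension 2n. Fewer than 2n vectors cannot span it, which keeps Gram-Schmidt going, and 2n
  independent ones must.\<close>

lemma orthonormal_D_exists: "\<exists>e. orthonormal_basis_at g DD (2 * n) p e"
proof -
  have "has_dimension ((\<lambda>X. \<phi> X \<^bold>@ p) ` VF) (2 * n)"
    using mf by (auto simp: metric_f_manifold_def)
  then obtain B where B: "finite B" "card B = 2 * n" "\<not> tvector.dependent B"
    "tspan B = (\<lambda>X. \<phi> X \<^bold>@ p) ` VF" by (auto simp: has_dimension_def)
  have DB: "X \<^bold>@ p \<in> tspan B" if "X \<in> DD" for X
  proof -
    have "X = \<phi> (- \<phi> X)" using that by (simp add: phi_uminus phi_phi_D)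
    then show ?thesis unfolding B(4) using that by (metis D_vf imageI phi_vf uminus_vf)
  qed
  have BD: "\<exists>X\<in>DD. v = X \<^bold>@ p" if "v \<in> B" for v
    using tvector.span_base[OF that] unfolding B(4) by (metis (no_types, lifting) imageE phi_D)
  \<comment> \<open>Independence and the cardinality are carried along for the dimension counts; the
    cardinality says that the values at \<open>p\<close> are distinct.\<close>
  define P where "P k e \<longleftrightarrow> (\<forall>a<k. e a \<in> DD) \<and>
    (\<forall>a<k. \<forall>b<k. g (e a) (e b) p = (if a = b then 1 else 0)) \<and>
    \<not> tvector.dependent ((\<lambda>a. e a \<^bold>@ p) ` {..<k}) \<and> card ((\<lambda>a. e a \<^bold>@ p) ` {..<k}) = k" for k e
  have ex: "\<exists>e. P k e" if "k \<le> 2 * n" for k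
    using that
  proof (induction k)
    case 0
    then show ?case by (simp add: P_def tvector.independent_empty)
  next
    case (Suc k)
    then obtain e where e: "P k e" by auto
    let ?I = "(\<lambda>a. e a \<^bold>@ p) ` {..<k}"
    have "\<exists>X\<in>DD. X \<^bold>@ p \<notin> tspan ?I"
    proof (rule ccontr)
      assume "\<not> ?thesis"
      then have "B \<subseteq> tspan ?I" using BD by fastforce
      then have "card B \<le> card ?I"
        using tvector.independent_span_bound[of ?I B] B by auto
      also have "\<dots> \<le> k" using card_image_le[of "{..<k}"] by fastforce
      finally show False using B(2) Suc.prems by simp
    qed
    then obtain X where X: "X \<in> DD" "X \<^bold>@ p \<notin> tspan ?I" by blast
    have e1: "\<And>a. a < k \<Longrightarrow> e a \<in> DD"
      and e2: "\<And>a b. a < k \<Longrightarrow> b < k \<Longrightarrow> g (e a) (e b) p = (if a = b then 1 else 0)"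
      and e3: "\<not> tvector.dependent ?I" and e4: "card ?I = k"
      using e by (auto simp: P_def)
    obtain Y where Y: "Y \<in> DD" "\<And>a. a < k \<Longrightarrow> g (e a) Y p = 0" "g Y Y p = 1" "Y \<^bold>@ p \<notin> tspan ?I"
      using orthonormal_D_step[OF e1 e2 X] by blast
    have im: "(\<lambda>a. (e(k := Y)) a \<^bold>@ p) ` {..<Suc k} = insert (Y \<^bold>@ p) ?I"
      by (auto simp: lessThan_Suc)
    have Y': "g Y (e a) p = 0" if "a < k" for a
      using Y(2)[OF that] g_sym[of Y "e a"] Y(1) e1[OF that] by simp
    have "P (Suc k) (e(k := Y))"
      unfolding P_def im
    proof (intro conjI)
      show "\<not> tvector.dependent (insert (Y \<^bold>@ p) ?I)"
        using Y(4) e3 by (simp add: tvector.independent_insertI)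
      have "Y \<^bold>@ p \<notin> ?I" using Y(4) tvector.span_base[of "Y \<^bold>@ p" ?I] by argo
      then show "card (insert (Y \<^bold>@ p) ?I) = Suc k" using e4 by simp
      show "\<forall>a<Suc k. (e(k := Y)) a \<in> DD"
        using e1 Y(1) by (metis fun_upd_apply less_antisym)
      show "\<forall>a<Suc k. \<forall>b<Suc k. g ((e(k := Y)) a) ((e(k := Y)) b) p = (if a = b then 1 else 0)"
      proof (intro allI impI)
        fix a b assume "a < Suc k" "b < Suc k"
        then have "a = k \<or> a < k" "b = k \<or> b < k" by auto
        then show "g ((e(k := Y)) a) ((e(k := Y)) b) p = (if a = b then 1 else 0)"
          using e2[of a b] Y(2)[of a] Y'[of b] Y(3) by (elim disjE) simp_all
      qed
    qed
    then show ?case by blast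
  qed
  then obtain e where e: "P (2 * n) e" by blast
  let ?I = "(\<lambda>a. e a \<^bold>@ p) ` {..<2 * n}"
  have IB: "?I \<subseteq> tspan B" using e DB by (auto simp: P_def)
  have "X \<^bold>@ p \<in> tspan ?I" if X: "X \<in> DD" for X
  proof (rule ccontr)
    assume n: "X \<^bold>@ p \<notin> tspan ?I"
    then have "\<not> tvector.dependent (insert (X \<^bold>@ p) ?I)"
      using e by (simp add: tvector.independent_insertI P_def)
    moreover have "insert (X \<^bold>@ p) ?I \<subseteq> tspan B" using IB DB[OF X] by simp
    ultimately have "card (insert (X \<^bold>@ p) ?I) \<le> card B"
      using tvector.independent_span_bound[OF B(1)] by blast
    moreover have "X \<^bold>@ p \<notin> ?I" using n tvector.span_base[of "X \<^bold>@ p" ?I] by argo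
    ultimately show False using e B(2) by (simp add: P_def)
  qed
  then have "orthonormal_basis_at g DD (2 * n) p e"
    using e by (auto simp: orthonormal_basis_at_def P_def)
  then show ?thesis by blast
qed

lemma D_decomposition:
  assumes "X \<in> VF"
  shows "X + (\<Sum>i<s. (- \<eta> i X) \<odot> \<xi> i) \<in> DD" "X = (X + (\<Sum>i<s. (- \<eta> i X) \<odot> \<xi> i)) + (\<Sum>i<s. \<eta> i X \<odot> \<xi> i)"
proof -
  have "X + (\<Sum>i<s. (- \<eta> i X) \<odot> \<xi> i) = - \<phi> (\<phi> X)"
    using assms by (simp add: phi_phi fscale_minus_left sum_negf)
  then show "X + (\<Sum>i<s. (- \<eta> i X) \<odot> \<xi> i) \<in> DD"
    using assms by (auto intro!: D_I simp: eta_uminus)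
  show "X = (X + (\<Sum>i<s. (- \<eta> i X) \<odot> \<xi> i)) + (\<Sum>i<s. \<eta> i X \<odot> \<xi> i)"
    by (simp add: fscale_minus_left sum_negf)
qed

lemma adapted_orthonormal:
  assumes e: "orthonormal_basis_at g DD (2 * n) p e"
  shows "orthonormal_basis_at g VF (2 * n + s) p (\<lambda>a. if a < 2 * n then e a else \<xi> (a - 2 * n))"
    (is "orthonormal_basis_at _ _ _ _ ?E")
  unfolding orthonormal_basis_at_def
proof (intro conjI allI impI ballI)
  have eD: "e a \<in> DD" if "a < 2 * n" for a using e that by (auto simp: orthonormal_basis_at_def)
  show "?E a \<in> VF" if "a < 2 * n + s" for a using that eD by auto
  show "g (?E a) (?E b) p = (if a = b then 1 else 0)" if "a < 2 * n + s" "b < 2 * n + s" for a b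
  proof -
    have "g (e a) (e b) p = (if a = b then 1 else 0)" if "a < 2 * n" "b < 2 * n"
      using e that by (auto simp: orthonormal_basis_at_def)
    moreover have "a - 2 * n < s" "b - 2 * n < s" if "\<not> a < 2 * n" "\<not> b < 2 * n"
      using \<open>a < 2 * n + s\<close> \<open>b < 2 * n + s\<close> that by auto
    ultimately show ?thesis
      using that eD by (auto simp: g_xi_left g_xi_right eta_xi pointwise)
  qed
  fix X assume X: "X \<in> VF"
  let ?Y = "X + (\<Sum>i<s. (- \<eta> i X) \<odot> \<xi> i)" and ?S = "tspan ((\<lambda>a. ?E a \<^bold>@ p) ` {..<2 * n + s})"
  have "?Y \<^bold>@ p \<in> tspan ((\<lambda>a. e a \<^bold>@ p) ` {..<2 * n})"
    using e D_decomposition(1)[OF X] by (auto simp: orthonormal_basis_at_def)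
  also have "\<dots> \<subseteq> ?S" by (intro tvector.span_mono) (auto simp: image_iff intro: bexI[of _ a for a])
  finally have 1: "?Y \<^bold>@ p \<in> ?S" .
  have "\<xi> i \<^bold>@ p \<in> ?S" if "i < s" for i
    using that by (intro tvector.span_base image_eqI[of _ _ "2 * n + i"]) auto
  then have "(\<Sum>i<s. \<eta> i X \<odot> \<xi> i) \<^bold>@ p \<in> ?S"
    unfolding value_at_sum value_at_fscale by (intro tvector.span_sum tvector.span_scale) auto
  from tvector.span_add[OF 1 this] show "X \<^bold>@ p \<in> ?S"
    unfolding value_at_add[symmetric] D_decomposition(2)[OF X, symmetric] .
qed

subsection \<open>The Ricci tensor\<close>

text \<open>The Ricci tensor of g in the completed basis. With \<open>e\<close> fixed it is visibly
  tensorial in \<open>X\<close>, whereas \<open>ricci\<close> chooses its basis anew.\<close>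

definition adapted_ricci :: "'m \<Rightarrow> (nat \<Rightarrow> 'm vfield) \<Rightarrow> 'm vfield \<Rightarrow> 'm vfield \<Rightarrow> real" where
  "adapted_ricci p e X Y = (\<Sum>a<2 * n. g (R X (e a) (e a)) Y p) + (\<Sum>i<s. g (R X (\<xi> i) (\<xi> i)) Y p)"

lemma basis_D: "orthonormal_basis_at g DD k p e \<Longrightarrow> a < k \<Longrightarrow> e a \<in> DD"
  by (auto simp: orthonormal_basis_at_def)

lemma basis_norm: "orthonormal_basis_at g DD k p e \<Longrightarrow> a < k \<Longrightarrow> g (e a) (e a) p = 1"
  by (auto simp: orthonormal_basis_at_def)

lemma ricci_eq_adapted:
  assumes e: "orthonormal_basis_at g DD (2 * n) p e" and X: "X \<in> VF" and Y: "Y \<in> VF"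
  shows "ricci g nab VF (2 * n + s) X Y p = adapted_ricci p e X Y"
proof -
  define e' where "e' = (SOME e. orthonormal_basis_at g VF (2 * n + s) p e)"
  note E = adapted_orthonormal[OF e]
  have e': "orthonormal_basis_at g VF (2 * n + s) p e'"
    unfolding e'_def by (rule someI[of _ "\<lambda>a. if a < 2 * n then e a else \<xi> (a - 2 * n)"]) (rule E)
  have "ricci g nab VF (2 * n + s) X Y p = (\<Sum>a<2 * n + s. g (R X (e' a) (e' a)) Y p)"
    by (simp add: ricci_def e'_def Let_def)
  also have "\<dots> = (\<Sum>a<2 * n + s. g (R X (if a < 2 * n then e a else \<xi> (a - 2 * n))
      (if a < 2 * n then e a else \<xi> (a - 2 * n))) Y p)"
    by (rule trace_independent[OF e' E, of "\<lambda>V W. g (R X V W) Y p"]) (use curvature_tensorial X Y in auto)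
  finally show ?thesis by (simp add: sum_lessThan_add adapted_ricci_def)
qed

lemma tensorial_at_add_fun: "tensorial_at p L \<Longrightarrow> tensorial_at p L' \<Longrightarrow> tensorial_at p (\<lambda>X. L X + L' X)"
  by (simp add: tensorial_at_def algebra_simps)

lemma tensorial_at_sum_fun:
  "(\<And>i. i \<in> I \<Longrightarrow> tensorial_at p (L i)) \<Longrightarrow> tensorial_at p (\<lambda>X. \<Sum>i\<in>I. L i X)"
  by (induction I rule: infinite_finite_induct)
    (simp_all add: tensorial_at_add_fun, simp_all add: tensorial_at_def)

lemma adapted_ricci_tensorial:
  assumes e: "orthonormal_basis_at g DD (2 * n) p e" and "Y \<in> VF"
  shows "tensorial_at p (\<lambda>X. adapted_ricci p e X Y)"
  unfolding adapted_ricci_def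
  by (intro tensorial_at_add_fun tensorial_at_sum_fun curvature_tensorial) (use assms basis_D[OF e] in auto)

lemma adapted_ricci_sym:
  assumes e: "orthonormal_basis_at g DD (2 * n) p e" and X: "X \<in> VF" and Y: "Y \<in> VF"
  shows "adapted_ricci p e X Y = adapted_ricci p e Y X"
proof -
  have "g (R X E E) Y p = g (R Y E E) X p" if E: "E \<in> VF" for E
    using curvature_pair_sym[OF X E E Y] curvature_skew_right[OF E Y X E] curvature_skew[OF E Y E] X Y E
    by (simp add: g_uminus_left pointwise)
  then show ?thesis
    using basis_D[OF e] by (simp add: adapted_ricci_def)
qed

text \<open>Skewness moves \<xi>_j into the third slot of the curvature, where
  \<open>curvature_xi\<close> applies. The vertical summands vanish because R(X, \<xi>_i) \<xi>_i is
  horizontal.\<close>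

lemma adapted_ricci_xi:
  assumes e: "orthonormal_basis_at g DD (2 * n) p e" and j: "j < s" and X: "X \<in> VF"
  shows "adapted_ricci p e X (\<xi> j) =
    (\<Sum>a<2 * n. g (nab_phi X (e a)) (e a) p - g (nab_phi (e a) X) (e a) p)"
proof -
  have "g (R X (e a) (e a)) (\<xi> j) p = g (nab_phi X (e a)) (e a) p - g (nab_phi (e a) X) (e a) p"
    if "a < 2 * n" for a
    using curvature_skew_right[of X "e a" "e a" "\<xi> j"] basis_D[OF e that] X j
    by (simp add: curvature_xi g_minus_left pointwise)
  moreover have "g (R X (\<xi> i) (\<xi> i)) (\<xi> j) p = 0" if "i < s" for i
    using that j X by (simp add: curvature_xi_xi g_xi_right eta_uminus pointwise)
  ultimately show ?thesis by (simp add: adapted_ricci_def)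
qed

lemma adapted_ricci_D_xi:
  assumes e: "orthonormal_basis_at g DD (2 * n) p e" and j: "j < s" and X: "X \<in> DD"
  shows "adapted_ricci p e X (\<xi> j) = 0"
  using basis_D[OF e] X j by (simp add: adapted_ricci_xi[OF e] nab_phi_D)

lemma adapted_ricci_xi_xi:
  assumes e: "orthonormal_basis_at g DD (2 * n) p e" and i: "i < s" and j: "j < s"
  shows "adapted_ricci p e (\<xi> i) (\<xi> j) = 2 * real n"
proof -
  \<comment> \<open>Each horizontal basis vector contributes 1, as (\<nabla>_e \<phi>) \<xi>_i =
    \<phi>^2 e = -e; this is the origin of 2n.\<close>
  have "g (nab_phi (\<xi> i) (e a)) (e a) p - g (nab_phi (e a) (\<xi> i)) (e a) p = 1" if "a < 2 * n" for a
    using basis_D[OF e that] basis_norm[OF e that] i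
    by (simp add: nab_phi_xi_left nab_phi_xi_right phi_phi_D g_uminus_left pointwise)
  then show ?thesis using i j by (simp add: adapted_ricci_xi[OF e])
qed

text \<open>Both tensors are block diagonal for D and its complement. The vertical block of g is the
  identity matrix, while all entries of that of Ric are 2n, hence a single and a double sum.\<close>

lemma horizontal_parts:
  assumes "X \<in> VF" "Y \<in> VF"
  obtains X' Y' where "X' \<in> DD" "Y' \<in> DD"
    "\<And>p. g X Y p = g X' Y' p + (\<Sum>i<s. \<eta> i X p * \<eta> i Y p)"
    "\<And>p e. orthonormal_basis_at g DD (2 * n) p e \<Longrightarrow>
      adapted_ricci p e X Y = adapted_ricci p e X' Y' + 2 * real n * (\<Sum>i<s. \<Sum>j<s. \<eta> i X p * \<eta> j Y p)"
proof
  let ?h = "\<lambda>X. X + (\<Sum>i<s. (- \<eta> i X) \<odot> \<xi> i)"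
  show D: "?h X \<in> DD" "?h Y \<in> DD" using D_decomposition(1) assms by auto
  have ph: "\<phi> (?h Z) = \<phi> Z" if Z: "Z \<in> VF" for Z
  proof -
    have "\<phi> (\<Sum>i<s. (- \<eta> i Z) \<odot> \<xi> i) = 0"
      using Z by (subst phi_sum) (simp_all add: phi_fscale)
    then show ?thesis using Z by (simp add: phi_plus)
  qed
  have "g (?h X) (?h Y) = g (\<phi> X) (\<phi> Y)"
    using g_phi_phi[of "?h X" "?h Y"] D ph assms by simp
  then show "g X Y p = g (?h X) (?h Y) p + (\<Sum>i<s. \<eta> i X p * \<eta> i Y p)" for p
    using assms by (simp add: g_phi_phi pointwise sum_fun_apply)
  fix p e assume e: "orthonormal_basis_at g DD (2 * n) p e"
  have split: "adapted_ricci p e Z W = adapted_ricci p e (?h Z) W + (\<Sum>i<s. \<eta> i Z p * adapted_ricci p e (\<xi> i) W)"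
    if Z: "Z \<in> VF" and W: "W \<in> VF" for Z W
  proof -
    note t = adapted_ricci_tensorial[OF e W]
    have "adapted_ricci p e (?h Z + (\<Sum>i<s. \<eta> i Z \<odot> \<xi> i)) W =
      adapted_ricci p e (?h Z) W + adapted_ricci p e (\<Sum>i<s. \<eta> i Z \<odot> \<xi> i) W"
      using D_decomposition(1)[OF Z] Z by (intro tensorial_at_plus[OF t]) auto
    also have "adapted_ricci p e (\<Sum>i<s. \<eta> i Z \<odot> \<xi> i) W = (\<Sum>i<s. \<eta> i Z p * adapted_ricci p e (\<xi> i) W)"
      using Z by (intro tensorial_at_sum[OF t]) auto
    finally show ?thesis unfolding D_decomposition(2)[OF Z, symmetric] .
  qed
  \<comment> \<open>Only the first argument can be split, so the second is brought there by
    symmetry.\<close>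
  have 1: "adapted_ricci p e (?h X) Y = adapted_ricci p e (?h X) (?h Y)"
  proof -
    have "adapted_ricci p e Y (?h X) = adapted_ricci p e (?h Y) (?h X)"
      using split[OF assms(2) D_vf[OF D(1)]] adapted_ricci_D_xi[OF e _ D(1)]
        adapted_ricci_sym[OF e D_vf[OF D(1)]] by simp
    then show ?thesis using adapted_ricci_sym[OF e] D assms by simp
  qed
  have 2: "adapted_ricci p e (\<xi> i) Y = (\<Sum>j<s. \<eta> j Y p * (2 * real n))" if i: "i < s" for i
  proof -
    have "adapted_ricci p e Y (\<xi> i) = (\<Sum>j<s. \<eta> j Y p * (2 * real n))"
      using split[OF assms(2) xi_vf[OF i]] adapted_ricci_D_xi[OF e i D(2)] adapted_ricci_xi_xi[OF e _ i] by simp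
    then show ?thesis using adapted_ricci_sym[OF e xi_vf[OF i] assms(2)] by simp
  qed
  show "adapted_ricci p e X Y = adapted_ricci p e (?h X) (?h Y) + 2 * real n * (\<Sum>i<s. \<Sum>j<s. \<eta> i X p * \<eta> j Y p)"
    using split[OF assms] 1 2 by (simp add: sum_distrib_left mult_ac)
qed

subsection \<open>Transverse curvature\<close>

abbreviation "T \<equiv> transverse_connection s \<xi> \<eta> nab"

abbreviation "\<zeta> \<equiv> (\<Sum>i<s. \<xi> i)"

lemma zeta_vf [simp]: "\<zeta> \<in> VF"
  by (rule sum_vf) simp

lemma g_zeta_D: "Y \<in> DD \<Longrightarrow> g \<zeta> Y = 0"
  by (subst g_sum_left) (simp_all add: g_xi_left)

text \<open>The value does not depend on \<open>i\<close>, so the vertical part of \<nabla>_X Y is a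
  multiple of \<open>\<zeta>\<close>.\<close>

lemma eta_nab:
  assumes i: "i < s" and X: "X \<in> VF" and Y: "Y \<in> DD"
  shows "\<eta> i (nab X Y) = g Y (\<phi> X)"
proof -
  have "X (g Y (\<xi> i)) = 0" using i X Y by (simp add: g_xi_right)
  then have "g (nab X Y) (\<xi> i) = - g Y (nab X (\<xi> i))"
    using i X Y by (simp add: metric_compat[OF X] eq_neg_iff_add_eq_0)
  then show ?thesis using i X Y by (simp add: nab_xi g_uminus_right g_xi_right)
qed

text \<open>For horizontal X the correction along \<open>\<zeta>\<close> removes the vertical part
  of \<nabla>_X Y. For vertical X the \<phi>-term arises from [\<xi>_i, Y] = \<nabla>_{\<xi>_i} Y +
  \<phi> Y.\<close>

lemma transverse_connection_eq:
  assumes X: "X \<in> VF" and Y: "Y \<in> DD"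
  shows "T X Y = nab X Y + (\<Sum>i<s. \<eta> i X) \<odot> \<phi> Y + g (\<phi> Y) X \<odot> \<zeta>"
proof -
  define P where "P = (\<Sum>i<s. \<eta> i X \<odot> \<xi> i)"
  have P: "P \<in> VF" using X by (simp add: P_def)
  have phiP: "\<phi> P = 0"
    unfolding P_def using X by (subst phi_sum) (simp_all add: phi_fscale)
  have "nab P Y = (\<Sum>i<s. nab (\<eta> i X \<odot> \<xi> i) Y)"
    unfolding P_def using X Y by (intro nab_sum_left) simp_all
  also have "\<dots> = (\<Sum>i<s. \<eta> i X \<odot> lie_bracket (\<xi> i) Y) - (\<Sum>i<s. \<eta> i X \<odot> \<phi> Y)"
    using X Y by (simp add: nab_fscale_left nab_xi_left fscale_diff_right sum_subtractf)
  also have "(\<Sum>i<s. \<eta> i X \<odot> \<phi> Y) = (\<Sum>i<s. \<eta> i X) \<odot> \<phi> Y"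
    by (simp add: fscale_def fun_eq_iff sum_fun_apply pointwise sum_distrib_right)
  finally have nabP: "nab P Y = (\<Sum>i<s. \<eta> i X \<odot> lie_bracket (\<xi> i) Y) - (\<Sum>i<s. \<eta> i X) \<odot> \<phi> Y" .
  have 1: "D_part s \<xi> \<eta> (nab (X - P) Y) = nab X Y - nab P Y + g (\<phi> Y) X \<odot> \<zeta>"
    using X Y P phiP phi_skew[of Y X]
    by (simp add: D_part_def D_perp_part_def eta_nab phi_minus nab_minus_left fscale_sum_right
        fscale_minus_left eta_minus sum_negf)
  have br: "lie_bracket P Y = (\<Sum>i<s. \<eta> i X \<odot> lie_bracket (\<xi> i) Y) - (\<Sum>i<s. Y (\<eta> i X) \<odot> \<xi> i)"
  proof -
    have "lie_bracket P Y = (\<Sum>i<s. lie_bracket (\<eta> i X \<odot> \<xi> i) Y)"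
      unfolding P_def using X Y by (intro lie_bracket_sum_left) simp_all
    also have "\<dots> = (\<Sum>i<s. \<eta> i X \<odot> lie_bracket (\<xi> i) Y - Y (\<eta> i X) \<odot> \<xi> i)"
      using X Y by (intro sum.cong) (simp_all add: lie_bracket_fscale_left)
    finally show ?thesis by (simp add: sum_subtractf)
  qed
  \<comment> \<open>The derivatives of the coefficients of \<open>P\<close> are thus the whole
    vertical part of the bracket, and the projection to D discards them.\<close>
  have "\<eta> j (lie_bracket P Y) = - Y (\<eta> j X)" if j: "j < s" for j
  proof -
    have "\<eta> j P = (\<Sum>i<s. \<eta> j (\<eta> i X \<odot> \<xi> i))"
      unfolding P_def using X j by (intro eta_sum) simp_all
    also have "\<dots> = (\<Sum>i<s. if i = j then \<eta> j X else 0)"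
      using X j by (intro sum.cong) (auto simp: eta_fscale eta_xi)
    finally have "\<eta> j P = \<eta> j X" using j by simp
    then show ?thesis
      using X Y P phiP j phi_skew[of P Y] by (simp add: eta_bracket)
  qed
  then have 2: "D_part s \<xi> \<eta> (lie_bracket P Y) = (\<Sum>i<s. \<eta> i X \<odot> lie_bracket (\<xi> i) Y)"
    by (simp add: D_part_def D_perp_part_def br fscale_minus_left sum_negf)
  have "T X Y = D_part s \<xi> \<eta> (nab (X - P) Y) + D_part s \<xi> \<eta> (lie_bracket P Y)"
    by (simp add: transverse_connection_def P_def D_part_def[of s \<xi> \<eta> X] D_perp_part_def)
  then show ?thesis by (simp add: 1 2 nabP)
qed

lemma transverse_connection_D:
  assumes X: "X \<in> DD" and Y: "Y \<in> DD"
  shows "T X Y = nab X Y + g (\<phi> Y) X \<odot> \<zeta>" "T X Y \<in> DD"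
proof -
  show eq: "T X Y = nab X Y + g (\<phi> Y) X \<odot> \<zeta>"
    using X Y by (simp add: transverse_connection_eq)
  have "\<eta> j \<zeta> = 1" if "j < s" for j
    using that by (subst eta_sum) (simp_all add: eta_xi)
  then show "T X Y \<in> DD"
    unfolding eq using X Y phi_skew[of Y X]
    by (intro D_I) (simp_all add: eta_plus eta_fscale eta_nab)
qed

lemma g_transverse_connection:
  assumes "X \<in> DD" "Y \<in> DD" "Z \<in> DD"
  shows "g (T X Y) Z = g (nab X Y) Z"
  using assms by (simp add: transverse_connection_D(1) g_plus_left g_fscale_left g_zeta_D)

text \<open>A counterpart of O'Neill's formula for submersions. One s comes from differentiating
  \<open>\<zeta>\<close> in T_E T_X E, and 2s from the vertical part of [X, E], since
  \<eta>_i([X, E]) = -2 g(X, \<phi> E) for each i. T_E E needs no correction because \<phi> E is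
  orthogonal to E.\<close>

lemma transverse_curvature:
  assumes X: "X \<in> DD" and E: "E \<in> DD" and Y: "Y \<in> DD"
  shows "g (curvature T X E E) Y p = g (R X E E) Y p + 3 * real s * (g (\<phi> E) X p * g (\<phi> E) Y p)"
proof -
  note vf = D_vf[OF X] D_vf[OF E] D_vf[OF Y]
  let ?h = "g (\<phi> E) X"
  have EE: "T E E = nab E E"
    using transverse_connection_D(1)[OF E E] phi_skew[of E E] g_phi_self[of E] vf by simp
  have 1: "g (T X (T E E)) Y = g (nab X (nab E E)) Y"
    using g_transverse_connection[OF X transverse_connection_D(2)[OF E E] Y] EE by simp
  have "nab E \<zeta> = (\<Sum>i<s. nab E (\<xi> i))"
    using vf by (intro nab_sum_right) simp_all
  also have "\<dots> = (\<Sum>i<s. - \<phi> E)" using vf by (simp add: nab_xi)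
  finally have "g (nab E \<zeta>) Y = (\<Sum>i<s. g (- \<phi> E) Y)"
    using vf by (simp add: g_sum_left del: sum_constant)
  then have z: "g (nab E \<zeta>) Y p = - real s * g (\<phi> E) Y p"
    using vf by (simp only: sum_fun_apply) (simp add: g_uminus_left pointwise)
  have "g (T E (T X E)) Y = g (nab E (nab X E + ?h \<odot> \<zeta>)) Y"
    using g_transverse_connection[OF E transverse_connection_D(2)[OF X E] Y]
      transverse_connection_D(1)[OF X E] by simp
  \<comment> \<open>The derivative of the coefficient \<open>?h\<close> multiplies
    \<open>\<zeta>\<close>, which is orthogonal to \<open>Y\<close>.\<close>
  also have "\<dots> = g (nab E (nab X E)) Y + ?h * g (nab E \<zeta>) Y"
    using vf Y by (simp add: nab_plus_right nab_fscale_right g_plus_left g_fscale_left g_zeta_D)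
  finally have 2: "g (T E (T X E)) Y p = g (nab E (nab X E)) Y p - real s * (?h p * g (\<phi> E) Y p)"
    by (simp add: pointwise z)
  have sg: "(\<Sum>i<s. \<eta> i (lie_bracket X E)) p = - 2 * real s * ?h p"
    using vf X E g_sym[of X "\<phi> E"] by (simp add: eta_bracket sum_fun_apply pointwise)
  have sgC: "(\<Sum>i<s. \<eta> i (lie_bracket X E)) \<in> C" using vf by (intro sum_smooth) simp
  have "g (T (lie_bracket X E) E) Y = g (nab (lie_bracket X E) E) Y
      + (\<Sum>i<s. \<eta> i (lie_bracket X E)) * g (\<phi> E) Y"
    using vf E Y sgC by (simp add: transverse_connection_eq g_plus_left g_fscale_left g_zeta_D)
  then have 3: "g (T (lie_bracket X E) E) Y p =
      g (nab (lie_bracket X E) E) Y p - 2 * real s * (?h p * g (\<phi> E) Y p)"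
    by (simp add: pointwise sg)
  have V: "T X (T E E) \<in> VF" "T E (T X E) \<in> VF" "T (lie_bracket X E) E \<in> VF"
    using transverse_connection_D(2) X E vf sgC by (auto simp: transverse_connection_eq)
  have "g (curvature T X E E) Y p =
      g (T X (T E E)) Y p - g (T E (T X E)) Y p - g (T (lie_bracket X E) E) Y p"
    using V vf by (simp add: curvature_def g_minus_left pointwise)
  moreover have "g (R X E E) Y p =
      g (nab X (nab E E)) Y p - g (nab E (nab X E)) Y p - g (nab (lie_bracket X E) E) Y p"
    using vf by (simp add: curvature_def g_minus_left pointwise)
  ultimately show ?thesis using 1 2 3 by simp
qed

lemma transverse_ricci:
  assumes X: "X \<in> DD" and Y: "Y \<in> DD"
  shows "ricci g T DD (2 * n) X Y p = ricci g nab VF (2 * n + s) X Y p + 2 * real s * g X Y p"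
proof -
  note vf = D_vf[OF X] D_vf[OF Y]
  define e where "e = (SOME e. orthonormal_basis_at g DD (2 * n) p e)"
  have e: "orthonormal_basis_at g DD (2 * n) p e"
    unfolding e_def by (rule someI_ex[OF orthonormal_D_exists])
  \<comment> \<open>Moving \<phi> onto X and Y makes this the expansion of g(\<phi> X, \<phi> Y),
    which is g(X, Y) on D.\<close>
  have "(\<Sum>a<2 * n. g (\<phi> (e a)) X p * g (\<phi> (e a)) Y p) =
      (\<Sum>a<2 * n. g (\<phi> X) (e a) p * g (e a) (\<phi> Y) p)"
  proof (intro sum.cong refl)
    fix a assume "a \<in> {..<2 * n}"
    then have E: "e a \<in> VF" using basis_D[OF e] by simp
    then show "g (\<phi> (e a)) X p * g (\<phi> (e a)) Y p = g (\<phi> X) (e a) p * g (e a) (\<phi> Y) p"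
      using vf phi_skew[OF E vf(1)] phi_skew[OF E vf(2)] g_sym[of "\<phi> X" "e a"] by (simp add: pointwise)
  qed
  also have "\<dots> = g (\<phi> X) (\<phi> Y) p"
    using vf by (intro orthonormal_expansion[OF e, symmetric] g_tensorial) auto
  also have "\<dots> = g X Y p" using X Y by (simp add: g_phi_phi pointwise)
  finally have sum: "(\<Sum>a<2 * n. g (\<phi> (e a)) X p * g (\<phi> (e a)) Y p) = g X Y p" .
  have "ricci g T DD (2 * n) X Y p = (\<Sum>a<2 * n. g (curvature T X (e a) (e a)) Y p)"
    by (simp add: ricci_def e_def Let_def)
  also have "\<dots> = (\<Sum>a<2 * n. g (R X (e a) (e a)) Y p + 3 * real s * (g (\<phi> (e a)) X p * g (\<phi> (e a)) Y p))"
    using basis_D[OF e] X Y by (intro sum.cong transverse_curvature) auto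
  also have "\<dots> = (\<Sum>a<2 * n. g (R X (e a) (e a)) Y p) + 3 * real s * g X Y p"
    by (simp add: sum.distrib sum_distrib_left[symmetric] sum)
  \<comment> \<open>Each of the s vertical summands g(R(X, \<xi>_i) \<xi>_i, Y) in the Ricci tensor
    of g equals g(X, Y), which lowers 3s to 2s.\<close>
  also have "\<dots> = adapted_ricci p e X Y + 2 * real s * g X Y p"
    using X Y by (simp add: adapted_ricci_def curvature_xi_xi phi_phi_D)
  finally show ?thesis using ricci_eq_adapted[OF e] vf by simp
qed

section \<open>The two implications\<close>

lemma eta_Einstein_imp:
  assumes "eta_Einstein A n s \<eta> g nab \<alpha> \<beta>"
  shows "transverse_Kaehler_Einstein A n s \<xi> \<eta> g nab (\<alpha> + 2 * real s)"
  unfolding transverse_Kaehler_Einstein_def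
proof (intro ballI allI)
  fix X Y p assume X: "X \<in> DD" and Y: "Y \<in> DD"
  have "ricci g nab VF (2 * n + s) X Y p = \<alpha> * g X Y p"
    using assms X Y by (simp add: eta_Einstein_def pointwise)
  then show "ricci g T DD (2 * n) X Y p = (\<alpha> + 2 * real s) * g X Y p"
    using transverse_ricci[OF X Y] by (simp add: algebra_simps)
qed

lemma transverse_Kaehler_Einstein_imp:
  assumes "transverse_Kaehler_Einstein A n s \<xi> \<eta> g nab c"
  shows "eta_Einstein A n s \<eta> g nab (c - 2 * real s) (2 * real n - (c - 2 * real s))"
  unfolding eta_Einstein_def
proof (intro ballI allI)
  fix X Y p assume X: "X \<in> VF" and Y: "Y \<in> VF"
  obtain e where e: "orthonormal_basis_at g DD (2 * n) p e" using orthonormal_D_exists by blast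
  obtain X' Y' where D: "X' \<in> DD" "Y' \<in> DD"
    and g: "\<And>p. g X Y p = g X' Y' p + (\<Sum>i<s. \<eta> i X p * \<eta> i Y p)"
    and r: "\<And>p e. orthonormal_basis_at g DD (2 * n) p e \<Longrightarrow>
      adapted_ricci p e X Y = adapted_ricci p e X' Y' + 2 * real n * (\<Sum>i<s. \<Sum>j<s. \<eta> i X p * \<eta> j Y p)"
    using horizontal_parts[OF X Y] by blast
  have "ricci g T DD (2 * n) X' Y' p = c * g X' Y' p"
    using assms D by (simp add: transverse_Kaehler_Einstein_def)
  then have "adapted_ricci p e X' Y' = (c - 2 * real s) * g X' Y' p"
    using transverse_ricci[OF D, of p] ricci_eq_adapted[OF e] D by (simp add: algebra_simps)
  \<comment> \<open>Replacing g(X', Y') by g(X, Y) minus the diagonal sum subtracts c - 2s from the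
    diagonal part of the 2n-block only. This leaves \<beta> there and 2n = \<alpha> + \<beta> off
    the diagonal.\<close>
  moreover have "(\<Sum>i<s. \<Sum>j<s. \<eta> i X p * \<eta> j Y p) =
      (\<Sum>i<s. \<eta> i X p * \<eta> i Y p) + (\<Sum>i<s. \<Sum>j\<in>{..<s} - {i}. \<eta> i X p * \<eta> j Y p)"
    unfolding sum.distrib[symmetric] by (intro sum.cong refl sum.remove) auto
  ultimately show "ricci g nab VF (2 * n + s) X Y p = (c - 2 * real s) * g X Y p
      + (2 * real n - (c - 2 * real s)) * (\<Sum>i<s. \<eta> i X p * \<eta> i Y p)
      + (c - 2 * real s + (2 * real n - (c - 2 * real s))) * (\<Sum>i<s. \<Sum>j\<in>{..<s} - {i}. \<eta> i X p * \<eta> j Y p)"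
    using r[OF e] g[of p] ricci_eq_adapted[OF e X Y] by (simp add: algebra_simps)
qed

end

theorem theorem2p12:
  fixes A :: "('m::{t2_space, second_countable_topology}, 'e::euclidean_space) chart set"
    and n s :: nat
    and \<phi> :: "'m vfield \<Rightarrow> 'm vfield"
    and \<xi> :: "nat \<Rightarrow> 'm vfield"
    and \<eta> :: "nat \<Rightarrow> 'm vfield \<Rightarrow> ('m \<Rightarrow> real)"
    and g :: "'m vfield \<Rightarrow> 'm vfield \<Rightarrow> ('m \<Rightarrow> real)"
    and nab :: "'m vfield \<Rightarrow> 'm vfield \<Rightarrow> 'm vfield"
  assumes "S_manifold A n s \<phi> \<xi> \<eta> g"
    and "levi_civita_connection A g nab"
  shows "(\<forall>\<alpha> \<beta>. eta_Einstein A n s \<eta> g nab \<alpha> \<beta> \<longrightarrow>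
            transverse_Kaehler_Einstein A n s \<xi> \<eta> g nab (\<alpha> + 2 * real s)) \<and>
         (\<forall>c. transverse_Kaehler_Einstein A n s \<xi> \<eta> g nab c \<longrightarrow>
            eta_Einstein A n s \<eta> g nab (c - 2 * real s)
              (2 * real n - (c - 2 * real s)))"
proof -
  interpret S_geometry A n s \<phi> \<xi> \<eta> g nab
    using assms by unfold_locales (auto simp: S_manifold_def metric_f_manifold_def)
  show ?thesis
    using eta_Einstein_imp transverse_Kaehler_Einstein_imp by blast
qed

end
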